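(* Assume $c_f:=\min_{1\le j\le d}\|f\|_{H^{-1}(\Omega_j)}>0$. Then there exist a sequence of linear subspaces $(V_n)_{n\ge1}$ of $H^1_0(\Omega)$ with $\dim V_n=n$, and a sequence $(\varepsilon_n)_{n\ge1}$ of positive numbers converging to $0$, such that $$\|u(y)-P_{V_n}u(y)\|_{H^1_0}\le\varepsilon_n\|u(y)\|_{H^1_0}$$ for all $y\in\widetilde Y=\,]0,\infty]^d$. Here $P_{V_n}$ is the $H^1_0(\Omega)$-orthogonal projector onto $V_n$.
   Context: Let $\Omega\subset\mathbb R^m$ be a bounded open domain, partitioned into disjoint open subdomains $\Omega_1,\dots,\Omega_d$ whose closures cover $\overline\Omega$. Equip $H^1_0(\Omega)$ with the inner product $\int\nabla u\cdot\nabla v$, and let $f\in H^{-1}(\Omega)$. Set $$\|f\|_{H^{-1}(\Omega_j)}:=\sup_{0\ne\phi\in H^1_0(\Omega_j)}\frac{\langle f,\phi\rangle}{\|\nabla\phi\|_{L^2}}.$$ For finite $y\in\,]0,\infty[^d$, $u(y)\in H^1_0(\Omega)$ solves $$\sum_j y_j\int_{\Omega_j}\nabla u(y)\cdot\nabla v\,dx=\langle f,v\rangle\quad\text{for all } v\in H^1_0(\Omega).$$ For $S\subset\{1,\dots,d\}$, let $V_S:=\{v\in H^1_0(\Omega):\nabla v|_{\Omega_j}=0\ \forall j\in S\}$. For finite positive $y_{S^c}$, let $u_S(y_{S^c})\in V_S$ solve $$\sum_{j\notin S}y_j\int_{\Omega_j}\nabla u_S\cdot\nabla v\,dx=\langle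 f,v\rangle\quad\text{for all } v\in V_S.$$ The map $u$ is extended to $]0,\infty]^d$ by $u(y):=u_S(y_{S^c})$ where $S=\{j:y_j=\infty\}$; in particular $u(\infty,\dots,\infty)=0$.
   Formalization: The partition is additionally assumed to leave out only a Lebesgue-null set, i.e. Ω minus the union of the Ω_j has measure zero; otherwise the form Σ y_j∫_{Ω_j}∇u·∇v is not coercive on H^1_0(Ω) and u(y) need not exist. The Ω_j are taken nonempty. *)

theory Defs
  imports "HOL-Analysis.Analysis"
begin

text \<open>Elements of H^1_0 are represented by pairs (u, G) of a (Borel) function u and its
  (weak) gradient G, both being L^2-limits of a sequence of C_c^infinity functions and their
  gradients.  All quantities below only depend on such pairs up to a.e. equality.\<close>

type_synonym 'm h1 = "((real^'m::finite) \<Rightarrow> real) \<times> ((real^'m::finite) \<Rightarrow> real^'m)"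

definition partial :: "'m::finite \<Rightarrow> ((real^'m::finite) \<Rightarrow> real) \<Rightarrow> (real^'m::finite) \<Rightarrow> real" where
  "partial i \<phi> x = frechet_derivative \<phi> (at x) (axis i 1)"

fun Dk :: "'m::finite list \<Rightarrow> ((real^'m::finite) \<Rightarrow> real) \<Rightarrow> (real^'m::finite) \<Rightarrow> real" where
  "Dk [] \<phi> = \<phi>"
| "Dk (i # is) \<phi> = partial i (Dk is \<phi>)"

definition smooth :: "((real^'m::finite) \<Rightarrow> real) \<Rightarrow> bool" where
  "smooth \<phi> \<longleftrightarrow> (\<forall>is x. Dk is \<phi> differentiable (at x))"

definition grad :: "((real^'m::finite) \<Rightarrow> real) \<Rightarrow> (real^'m::finite) \<Rightarrow> real^'m" where
  "grad \<phi> x = (\<chi> i. partial i \<phi> x)"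

definition tsupport :: "((real^'m::finite) \<Rightarrow> real) \<Rightarrow> (real^'m::finite) set" where
  "tsupport \<phi> = closure {x. \<phi> x \<noteq> 0}"

definition Ccinf :: "(real^'m::finite) set \<Rightarrow> ((real^'m::finite) \<Rightarrow> real) set" where
  "Ccinf U = {\<phi>. smooth \<phi> \<and> compact (tsupport \<phi>) \<and> tsupport \<phi> \<subseteq> U}"

definition L2d :: "((real^'m::finite) \<Rightarrow> 'b::real_normed_vector) \<Rightarrow> ((real^'m::finite) \<Rightarrow> 'b) \<Rightarrow> ennreal" where
  "L2d g h = (\<integral>\<^sup>+ x. ennreal ((norm (g x - h x))\<^sup>2) \<partial>lborel)"

definition H10 :: "(real^'m::finite) set \<Rightarrow> ('m::finite) h1 set" where
  "H10 U = {(u, G). u \<in> borel_measurable lborel \<and> G \<in> borel_measurable lborel \<and>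
     (\<exists>\<phi>. (\<forall>k. \<phi> k \<in> Ccinf U) \<and> (\<lambda>k. L2d (\<phi> k) u) \<longlonglongrightarrow> 0
                              \<and> (\<lambda>k. L2d (grad (\<phi> k)) G) \<longlonglongrightarrow> 0)}"

definition hadd :: "('m::finite) h1 \<Rightarrow> ('m::finite) h1 \<Rightarrow> ('m::finite) h1" where
  "hadd v w = (\<lambda>x. fst v x + fst w x, \<lambda>x. snd v x + snd w x)"

definition hscale :: "real \<Rightarrow> ('m::finite) h1 \<Rightarrow> ('m::finite) h1" where
  "hscale a v = (\<lambda>x. a * fst v x, \<lambda>x. a *\<^sub>R snd v x)"

definition hsub :: "('m::finite) h1 \<Rightarrow> ('m::finite) h1 \<Rightarrow> ('m::finite) h1" where
  "hsub v w = (\<lambda>x. fst v x - fst w x, \<lambda>x. snd v x - snd w x)"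

definition hlin :: "nat \<Rightarrow> (nat \<Rightarrow> real) \<Rightarrow> (nat \<Rightarrow> ('m::finite) h1) \<Rightarrow> ('m::finite) h1" where
  "hlin n c b = (\<lambda>x. \<Sum>i<n. c i * fst (b i) x, \<lambda>x. \<Sum>i<n. c i *\<^sub>R snd (b i) x)"

definition hip :: "('m::finite) h1 \<Rightarrow> ('m::finite) h1 \<Rightarrow> real" where
  "hip v w = (\<integral>x. snd v x \<bullet> snd w x \<partial>lborel)"

definition hnorm :: "('m::finite) h1 \<Rightarrow> real" where
  "hnorm v = sqrt (hip v v)"

definition aU :: "(real^'m::finite) set \<Rightarrow> ('m::finite) h1 \<Rightarrow> ('m::finite) h1 \<Rightarrow> real" where
  "aU U v w = (LINT x:U|lborel. snd v x \<bullet> snd w x)"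

definition Hminus1 :: "(real^'m::finite) set \<Rightarrow> (('m::finite) h1 \<Rightarrow> real) \<Rightarrow> bool" where
  "Hminus1 \<Omega> f \<longleftrightarrow>
     (\<forall>v\<in>H10 \<Omega>. \<forall>w\<in>H10 \<Omega>. \<forall>a b. f (hadd (hscale a v) (hscale b w)) = a * f v + b * f w) \<and>
     (\<exists>C. \<forall>v\<in>H10 \<Omega>. \<bar>f v\<bar> \<le> C * hnorm v)"

definition Hm1norm :: "(('m::finite) h1 \<Rightarrow> real) \<Rightarrow> (real^'m::finite) set \<Rightarrow> real" where
  "Hm1norm f U = Sup {f \<phi> / hnorm \<phi> | \<phi>. \<phi> \<in> H10 U \<and> hnorm \<phi> \<noteq> 0}"

definition VS :: "(real^'m::finite) set \<Rightarrow> (nat \<Rightarrow> (real^'m::finite) set) \<Rightarrow> nat set \<Rightarrow> ('m::finite) h1 set" where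
  "VS \<Omega> \<Omega>s S = {v \<in> H10 \<Omega>. \<forall>j\<in>S. AE x in lborel. x \<in> \<Omega>s j \<longrightarrow> snd v x = 0}"

text \<open>w is (a representative of) u(y) for y in ]0,infinity]^d, S = {j. y_j = infinity}\<close>
definition is_u :: "(real^'m::finite) set \<Rightarrow> (nat \<Rightarrow> (real^'m::finite) set) \<Rightarrow> nat \<Rightarrow> (('m::finite) h1 \<Rightarrow> real)
                    \<Rightarrow> (nat \<Rightarrow> ereal) \<Rightarrow> ('m::finite) h1 \<Rightarrow> bool" where
  "is_u \<Omega> \<Omega>s d f y w \<longleftrightarrow>
     (let S = {j. j < d \<and> y j = \<infinity>} in
       w \<in> VS \<Omega> \<Omega>s S \<and>
       (\<forall>v\<in>VS \<Omega> \<Omega>s S. (\<Sum>j\<in>{..<d} - S. real_of_ereal (y j) * aU (\<Omega>s j) w v) = f v))"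

text \<open>V is a linear subspace of H^1_0(Omega) of dimension n (dimension taken in H^1_0, i.e.
  modulo elements of norm zero)\<close>
definition subspace_dim :: "(real^'m::finite) set \<Rightarrow> ('m::finite) h1 set \<Rightarrow> nat \<Rightarrow> bool" where
  "subspace_dim \<Omega> V n \<longleftrightarrow>
     (\<exists>b. (\<forall>i<n. b i \<in> H10 \<Omega>) \<and> V = {hlin n c b | c. True} \<and>
          (\<forall>c. hnorm (hlin n c b) = 0 \<longrightarrow> (\<forall>i<n. c i = 0)))"

definition proj :: "('m::finite) h1 set \<Rightarrow> ('m::finite) h1 \<Rightarrow> ('m::finite) h1" where
  "proj V w = (SOME p. p \<in> V \<and> (\<forall>v\<in>V. hip (hsub w p) v = 0))"

end

theory Submission
  imports Defs
begin

text \<open>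
  By homogeneity, a solution u(y) with min y < \<open>\<infinity>\<close> may be rescaled so that min y = 1; testing against
  functions supported in a subdomain where y = 1 then bounds its norm below by c_f. It remains to
  show that the set A of rescaled solutions can be approximated uniformly by finite-dimensional spaces.

  If \<open>y \<le> (1 + \<delta>) y'\<close> coordinatewise, then u(y') is admissible in the minimisation of the
  energy that characterises u(y), and this gives
  \<open>\<parallel>u(y) - u(y')\<parallel>\<^sup>2 \<le> f(u(y)) - f(u(y')) + \<delta> f(u(y'))\<close>. Every sequence of parameters in [1, \<open>\<infinity>\<close>]^d
  has a subsequence along which such almost-monotonicity holds for all pairs of indices, and f is bounded and
  nonnegative on A; hence no sequence in A is uniformly separated. Therefore the
  greedy selection of basis elements from A (each at least half as far from the current span as possible)
  must produce errors tending to zero, since otherwise the selected elements would be separated.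
  No limit solutions, and hence no completeness of H^1_0, are needed.
\<close>

section \<open>Smooth functions\<close>

text \<open>For \<open>k = 0\<close> this is the classical flat function. The factor
  \<open>1 / t ^ k\<close> is carried along because differentiation only produces further members of
  this family, with larger \<open>k\<close>.\<close>

definition flat_exp :: "nat \<Rightarrow> real \<Rightarrow> real" where
  "flat_exp k t = (if 0 < t then exp (- (1 / t)) / t ^ k else 0)"

lemma flat_exp_tendsto_0: "(flat_exp k \<longlongrightarrow> 0) (at 0)"
proof -
  have "((\<lambda>x::real. x ^ k / exp x) \<longlongrightarrow> 0) at_top"
    by (rule tendsto_power_div_exp_0)
  then have "((\<lambda>t::real. exp (- (1 / t)) / t ^ k) \<longlongrightarrow> 0) (at_right 0)"
    by (simp add: filterlim_at_right_to_top exp_minus field_simps power_inverse)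
  then have "(flat_exp k \<longlongrightarrow> 0) (at_right 0)"
    by (rule Lim_transform_eventually)
       (auto simp: flat_exp_def eventually_at_filter)
  moreover have "(flat_exp k \<longlongrightarrow> 0) (at_left 0)"
    by (rule tendsto_eventually) (auto simp: flat_exp_def eventually_at_filter)
  ultimately show ?thesis
    by (simp add: filterlim_split_at)
qed

lemma flat_exp_has_derivative:
  "(flat_exp k has_real_derivative (flat_exp (k + 2) t - real k * flat_exp (k + 1) t)) (at t)"
proof -
  consider "t < 0" | "t = 0" | "0 < t" by linarith
  then show ?thesis
  proof cases
    case 1
    have "\<forall>\<^sub>F s in nhds t. 0 = flat_exp k s"
      using 1 eventually_nhds_in_open[of "{..<0}" t]
      by (auto simp: flat_exp_def elim!: eventually_mono)
    moreover have "((\<lambda>_. 0) has_real_derivative 0) (at t)" by simp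
    ultimately show ?thesis
      using 1 by (subst DERIV_cong_ev[OF refl _ refl, of _ "\<lambda>_. 0"]) (auto simp: flat_exp_def elim: eventually_mono)
  next
    case 2
    \<comment> \<open>At the origin the difference quotient of \<open>flat_exp k\<close> is
      \<open>flat_exp (k + 1)\<close>, whose limit is known.\<close>
    have "(\<lambda>h. (flat_exp k (0 + h) - flat_exp k 0) / h) = flat_exp (k + 1)"
      by (auto simp: flat_exp_def fun_eq_iff field_simps)
    then show ?thesis
      using 2 flat_exp_tendsto_0[of "k + 1"] by (simp add: DERIV_def flat_exp_def)
  next
    case 3
    have e: "((\<lambda>t. exp (- (1 / t))) has_real_derivative exp (- (1 / t)) / t\<^sup>2) (at t)"
      using 3 by (auto intro!: derivative_eq_intros simp: power2_eq_square)
    \<comment> \<open>\<open>DERIV_pow\<close> yields the exponent \<open>k - 1\<close>, truncated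
      at \<open>k = 0\<close>; hence the case split on \<open>k\<close>.\<close>
    have "(exp (- (1 / t)) / t\<^sup>2 * t ^ k - exp (- (1 / t)) * (real k * t ^ (k - 1))) / (t ^ k * t ^ k)
        = exp (- (1 / t)) / t ^ (k + 2) - real k * (exp (- (1 / t)) / t ^ (k + 1))"
      using 3 by (cases k) (simp_all add: divide_simps power2_eq_square algebra_simps)
    then have "((\<lambda>t. exp (- (1 / t)) / t ^ k) has_real_derivative
        exp (- (1 / t)) / t ^ (k + 2) - real k * (exp (- (1 / t)) / t ^ (k + 1))) (at t)"
      using DERIV_divide[OF e DERIV_pow[of k t]] 3 by simp
    moreover have "\<forall>\<^sub>F s in nhds t. exp (- (1 / s)) / s ^ k = flat_exp k s"
      using 3 eventually_nhds_in_open[of "{0<..}" t]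
      by (auto simp: flat_exp_def elim!: eventually_mono)
    ultimately show ?thesis
      using 3 by (subst DERIV_cong_ev[OF refl _ refl, of _ "\<lambda>t. exp (- (1 / t)) / t ^ k"])
        (auto simp: flat_exp_def elim: eventually_mono)
  qed
qed

text \<open>A class of functions that visibly consists of differentiable functions and is closed under
  partial derivatives; smoothness of sums and bump functions follows without higher-order
  product or chain rules.\<close>

inductive smooth_alg :: "((real^'m::finite) \<Rightarrow> real) \<Rightarrow> bool" where
  base: "smooth \<phi> \<Longrightarrow> smooth_alg \<phi>"
| const: "smooth_alg (\<lambda>_. c)"
| coord: "smooth_alg (\<lambda>x. x $ i)"
| add: "smooth_alg \<phi> \<Longrightarrow> smooth_alg \<psi> \<Longrightarrow> smooth_alg (\<lambda>x. \<phi> x + \<psi> x)"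
| mult: "smooth_alg \<phi> \<Longrightarrow> smooth_alg \<psi> \<Longrightarrow> smooth_alg (\<lambda>x. \<phi> x * \<psi> x)"
| flat: "smooth_alg \<phi> \<Longrightarrow> smooth_alg (\<lambda>x. flat_exp k (\<phi> x))"

lemma Dk_append: "Dk is (Dk js \<phi>) = Dk (is @ js) \<phi>"
  by (induction "is") auto

lemma smooth_partial: "smooth \<phi> \<Longrightarrow> smooth (partial i \<phi>)"
  using Dk_append[of _ "[i]" \<phi>] by (auto simp: smooth_def)

lemma smooth_differentiable: "smooth \<phi> \<Longrightarrow> \<phi> differentiable (at x)"
  unfolding smooth_def by (metis Dk.simps(1))

lemma partialI: "(\<phi> has_derivative D) (at x) \<Longrightarrow> partial i \<phi> x = D (axis i 1)"
  using frechet_derivative_at[of \<phi> D x] by (simp add: partial_def)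

text \<open>The sum, product and chain rules express a partial derivative through the constructors
  of the class, applied to members and to their partial derivatives.\<close>

lemma smooth_alg_partial:
  "smooth_alg \<phi> \<Longrightarrow> (\<forall>x. \<phi> differentiable (at x)) \<and> (\<forall>i. smooth_alg (partial i \<phi>))"
proof (induction rule: smooth_alg.induct)
  case (base \<phi>)
  then show ?case by (auto intro: smooth_differentiable smooth_alg.base smooth_partial)
next
  case (const c)
  have "partial i (\<lambda>_. c) = (\<lambda>_. 0)" for i :: 'a
    by (rule ext, rule partialI) simp
  then show ?case by (auto intro: smooth_alg.const)
next
  case (coord i)
  have D: "((\<lambda>x::real^'a. x $ i) has_derivative (\<lambda>x. x $ i)) (at x)" for x
    by (rule bounded_linear_imp_has_derivative) (rule bounded_linear_vec_nth)
  have "partial j (\<lambda>x. x $ i) = (\<lambda>_. axis j 1 $ i)" for j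
    by (rule ext, rule partialI) (rule D)
  then show ?case using D by (auto intro: smooth_alg.const differentiableI)
next
  case (add \<phi> \<psi>)
  have D: "((\<lambda>x. \<phi> x + \<psi> x) has_derivative
      (\<lambda>h. frechet_derivative \<phi> (at x) h + frechet_derivative \<psi> (at x) h)) (at x)" for x
    using add by (auto intro!: has_derivative_add simp flip: frechet_derivative_works)
  have "partial i (\<lambda>x. \<phi> x + \<psi> x) = (\<lambda>x. partial i \<phi> x + partial i \<psi> x)" for i
    unfolding partial_def[of _ \<phi>] partial_def[of _ \<psi>] by (rule ext, rule partialI) (rule D)
  then show ?case using D add by (auto intro: smooth_alg.add differentiableI)
next
  case (mult \<phi> \<psi>)
  have D: "((\<lambda>x. \<phi> x * \<psi> x) has_derivative
      (\<lambda>h. \<phi> x * frechet_derivative \<psi> (at x) h + frechet_derivative \<phi> (at x) h * \<psi> x)) (at x)" for x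
    using mult by (auto intro!: has_derivative_mult simp flip: frechet_derivative_works)
  have "partial i (\<lambda>x. \<phi> x * \<psi> x) = (\<lambda>x. \<phi> x * partial i \<psi> x + partial i \<phi> x * \<psi> x)" for i
    unfolding partial_def[of _ \<phi>] partial_def[of _ \<psi>] by (rule ext, rule partialI) (rule D)
  moreover have "smooth_alg (\<lambda>x. \<phi> x * partial i \<psi> x + partial i \<phi> x * \<psi> x)" for i
    using mult by (intro smooth_alg.mult smooth_alg.add) auto
  ultimately show ?case using D by (auto intro: differentiableI)
next
  case (flat \<phi> k)
  \<comment> \<open>The derivative of \<open>flat_exp k\<close> is written as a sum with the factor
    \<open>- real k\<close>, since the class has no constructor for differences.\<close>
  have D: "((\<lambda>x. flat_exp k (\<phi> x)) has_derivative
      (\<lambda>h. (flat_exp (k + 2) (\<phi> x) + (- real k) * flat_exp (k + 1) (\<phi> x)) * frechet_derivative \<phi> (at x) h)) (at x)" for x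
  proof -
    have "(flat_exp k has_derivative (\<lambda>h. (flat_exp (k + 2) (\<phi> x) + (- real k) * flat_exp (k + 1) (\<phi> x)) * h)) (at (\<phi> x))"
      using flat_exp_has_derivative[of k "\<phi> x"] by (simp add: has_field_derivative_def)
    moreover have "(\<phi> has_derivative frechet_derivative \<phi> (at x)) (at x)"
      using flat by (auto simp flip: frechet_derivative_works)
    ultimately show ?thesis
      using has_derivative_compose by blast
  qed
  have "partial i (\<lambda>x. flat_exp k (\<phi> x))
      = (\<lambda>x. (flat_exp (k + 2) (\<phi> x) + (- real k) * flat_exp (k + 1) (\<phi> x)) * partial i \<phi> x)" for i
    unfolding partial_def[of _ \<phi>] by (rule ext, rule partialI) (rule D)
  moreover have "smooth_alg (\<lambda>x. (flat_exp (k + 2) (\<phi> x) + (- real k) * flat_exp (k + 1) (\<phi> x)) * partial i \<phi> x)" for i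
    using flat by (intro smooth_alg.mult smooth_alg.add smooth_alg.flat smooth_alg.const) auto
  ultimately show ?case using D by (auto intro: differentiableI)
qed

lemma smooth_alg_imp_smooth: "smooth_alg \<phi> \<Longrightarrow> smooth \<phi>"
proof -
  assume "smooth_alg \<phi>"
  then have "smooth_alg (Dk is \<phi>)" for "is"
    by (induction "is") (auto simp: smooth_alg_partial)
  then show ?thesis
    by (auto simp: smooth_def smooth_alg_partial)
qed

section \<open>Compactly supported smooth functions and their gradients\<close>

lemma smooth_add: "smooth \<phi> \<Longrightarrow> smooth \<psi> \<Longrightarrow> smooth (\<lambda>x. \<phi> x + \<psi> x)"
  by (rule smooth_alg_imp_smooth) (intro smooth_alg.add smooth_alg.base)

lemma smooth_cmult: "smooth \<phi> \<Longrightarrow> smooth (\<lambda>x. c * \<phi> x)"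
  by (rule smooth_alg_imp_smooth, rule smooth_alg.mult)
    (auto intro: smooth_alg.base smooth_alg.const)

lemma grad_add: "smooth \<phi> \<Longrightarrow> smooth \<psi> \<Longrightarrow> grad (\<lambda>x. \<phi> x + \<psi> x) x = grad \<phi> x + grad \<psi> x"
proof -
  assume s: "smooth \<phi>" "smooth \<psi>"
  have "((\<lambda>x. \<phi> x + \<psi> x) has_derivative
      (\<lambda>h. frechet_derivative \<phi> (at x) h + frechet_derivative \<psi> (at x) h)) (at x)"
    using s by (auto intro!: has_derivative_add smooth_differentiable simp flip: frechet_derivative_works)
  then show ?thesis
    by (simp add: grad_def vec_eq_iff partialI) (simp add: partial_def)
qed

lemma grad_cmult: "smooth \<phi> \<Longrightarrow> grad (\<lambda>x. c * \<phi> x) x = c *\<^sub>R grad \<phi> x"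
proof -
  assume s: "smooth \<phi>"
  have "((\<lambda>x. c * \<phi> x) has_derivative (\<lambda>h. c * frechet_derivative \<phi> (at x) h)) (at x)"
    using smooth_differentiable[OF s]
    by (auto intro!: has_derivative_mult_right simp flip: frechet_derivative_works)
  then show ?thesis
    by (simp add: grad_def vec_eq_iff partialI) (simp add: partial_def)
qed

lemma continuous_on_grad: "smooth \<phi> \<Longrightarrow> continuous_on UNIV (grad \<phi>)"
proof -
  assume s: "smooth \<phi>"
  have "continuous_on UNIV (partial i \<phi>)" for i
    using smooth_differentiable[OF smooth_partial[OF s]]
    by (auto intro!: continuous_at_imp_continuous_on differentiable_imp_continuous_within)
  then show ?thesis
    unfolding grad_def by (intro continuous_on_vec_lambda)
qed

lemma continuous_on_smooth: "smooth \<phi> \<Longrightarrow> continuous_on UNIV \<phi>"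
  using smooth_differentiable
  by (auto intro!: continuous_at_imp_continuous_on differentiable_imp_continuous_within)

lemma grad_eq_0_outside_tsupport:
  assumes "x \<notin> tsupport \<phi>"
  shows "grad \<phi> x = 0"
proof -
  have "open (- tsupport \<phi>)" by (auto simp: tsupport_def)
  moreover have "\<phi> y = 0" if "y \<in> - tsupport \<phi>" for y
    using that closure_subset[of "{x. \<phi> x \<noteq> 0}"] by (auto simp: tsupport_def)
  ultimately have "(\<phi> has_derivative (\<lambda>_. 0)) (at x)"
    using assms by (rule_tac has_derivative_transform_within_open[of "\<lambda>_. 0" _ x UNIV "- tsupport \<phi>"]) auto
  then show ?thesis
    by (simp add: grad_def vec_eq_iff partialI)
qed

lemma Ccinf_mono: "U \<subseteq> W \<Longrightarrow> Ccinf U \<subseteq> Ccinf W"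
  by (auto simp: Ccinf_def)

lemma Ccinf_add:
  assumes "\<phi> \<in> Ccinf U" "\<psi> \<in> Ccinf U"
  shows "(\<lambda>x. \<phi> x + \<psi> x) \<in> Ccinf U"
proof -
  have "{x. \<phi> x + \<psi> x \<noteq> 0} \<subseteq> {x. \<phi> x \<noteq> 0} \<union> {x. \<psi> x \<noteq> 0}" by auto
  then have sub: "tsupport (\<lambda>x. \<phi> x + \<psi> x) \<subseteq> tsupport \<phi> \<union> tsupport \<psi>"
    unfolding tsupport_def closure_Un[symmetric] by (rule closure_mono)
  have "compact (tsupport \<phi> \<union> tsupport \<psi>)" using assms by (auto simp: Ccinf_def)
  then have "compact (tsupport (\<lambda>x. \<phi> x + \<psi> x))"
    using sub compact_Int_closed[of "tsupport \<phi> \<union> tsupport \<psi>" "tsupport (\<lambda>x. \<phi> x + \<psi> x)"]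
    by (simp add: Int_absorb1 tsupport_def)
  then show ?thesis using assms sub by (auto simp: Ccinf_def smooth_add)
qed

lemma Ccinf_cmult:
  assumes "\<phi> \<in> Ccinf U"
  shows "(\<lambda>x. c * \<phi> x) \<in> Ccinf U"
proof -
  have "tsupport (\<lambda>x. c * \<phi> x) \<subseteq> tsupport \<phi>"
    unfolding tsupport_def by (intro closure_mono) auto
  moreover have "compact (tsupport (\<lambda>x. c * \<phi> x))"
    using calculation assms compact_Int_closed[of "tsupport \<phi>" "tsupport (\<lambda>x. c * \<phi> x)"]
    by (simp add: Int_absorb1 tsupport_def Ccinf_def)
  ultimately show ?thesis using assms by (auto simp: Ccinf_def smooth_cmult)
qed

lemma square_integrable_grad:
  assumes "\<phi> \<in> Ccinf U"
  shows "integrable lborel (\<lambda>x. (norm (grad \<phi> x))\<^sup>2)"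
proof -
  have s: "smooth \<phi>" and c: "compact (tsupport \<phi>)" using assms by (auto simp: Ccinf_def)
  have "continuous_on (tsupport \<phi>) (\<lambda>x. (norm (grad \<phi> x))\<^sup>2)"
    using continuous_on_subset[OF continuous_on_grad[OF s]] by (auto intro!: continuous_intros)
  from borel_integrable_compact[OF c this]
  have "integrable lborel (\<lambda>x. indicator (tsupport \<phi>) x *\<^sub>R (norm (grad \<phi> x))\<^sup>2)" .
  moreover have "indicator (tsupport \<phi>) x *\<^sub>R (norm (grad \<phi> x))\<^sup>2 = (norm (grad \<phi> x))\<^sup>2" for x
    using grad_eq_0_outside_tsupport[of x \<phi>] by (auto simp: indicator_def)
  ultimately show ?thesis by (simp only:)
qed

text \<open>The bump is the flat function of \<open>r^2 - |x - a|^2\<close> for a closed ball inside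
  \<open>U\<close>. An everywhere vanishing gradient would make it constant, yet it is nonzero at
  the centre and zero off the ball.\<close>

lemma exists_bump:
  fixes U :: "(real^'m::finite) set"
  assumes "open U" "U \<noteq> {}"
  shows "\<exists>\<phi>\<in>Ccinf U. \<exists>x. grad \<phi> x \<noteq> 0"
proof -
  obtain a r where r: "0 < r" "cball a r \<subseteq> U"
    using assms open_contains_cball by blast
  \<comment> \<open>A polynomial in the coordinates, so that the rules of \<open>smooth_alg\<close>
    apply.\<close>
  define q where "q = (\<lambda>x::real^'m. r\<^sup>2 + (-1) * (\<Sum>i\<in>UNIV. (x $ i + - (a $ i)) * (x $ i + - (a $ i))))"
  have q: "q x = r\<^sup>2 - (norm (x - a))\<^sup>2" for x
    unfolding q_def power2_norm_eq_inner inner_vec_def by simp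
  have sm: "smooth_alg (\<lambda>x. \<Sum>i\<in>I. g i x)" if "finite I" "\<And>i. smooth_alg (g i)" for I and g :: "'m \<Rightarrow> (real^'m) \<Rightarrow> real"
    using that(1) by induction (auto intro: smooth_alg.const smooth_alg.add that(2))
  have sa: "smooth_alg (\<lambda>x. flat_exp 0 (q x))"
    unfolding q_def
    by (intro smooth_alg.flat smooth_alg.add smooth_alg.mult smooth_alg.const sm smooth_alg.coord) simp
  define \<phi> where "\<phi> = (\<lambda>x. flat_exp 0 (q x))"
  have s: "smooth \<phi>" unfolding \<phi>_def by (rule smooth_alg_imp_smooth[OF sa])
  have "{x. \<phi> x \<noteq> 0} \<subseteq> cball a r"
  proof
    fix x assume "x \<in> {x. \<phi> x \<noteq> 0}"
    then have "(norm (x - a))\<^sup>2 < r\<^sup>2"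
      by (auto simp: \<phi>_def flat_exp_def q split: if_splits)
    then show "x \<in> cball a r"
      using r(1) by (auto simp: dist_norm norm_minus_commute dest: power_less_imp_less_base)
  qed
  then have sub: "tsupport \<phi> \<subseteq> cball a r"
    unfolding tsupport_def by (intro closure_minimal) auto
  then have "compact (tsupport \<phi>)"
    using compact_Int_closed[of "cball a r" "tsupport \<phi>"] by (simp add: Int_absorb1 tsupport_def)
  then have C: "\<phi> \<in> Ccinf U" using s sub r by (auto simp: Ccinf_def)
  have "\<exists>x. grad \<phi> x \<noteq> 0"
  proof (rule ccontr)
    assume *: "\<not> ?thesis"
    have "(\<phi> has_derivative (\<lambda>_. 0)) (at x)" for x
    proof -
      have d: "(\<phi> has_derivative frechet_derivative \<phi> (at x)) (at x)"
        using smooth_differentiable[OF s] by (simp flip: frechet_derivative_works)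
      have "frechet_derivative \<phi> (at x) (axis i 1) = 0" for i
        using * by (auto simp: grad_def partial_def vec_eq_iff)
      then have "frechet_derivative \<phi> (at x) = (\<lambda>_. 0)"
        using has_derivative_linear[OF d]
        by (intro linear_eq_stdbasis) (auto simp: Basis_vec_def linear_iff)
      then show ?thesis using d by simp
    qed
    then obtain c where c: "\<And>x. \<phi> x = c"
      using has_derivative_zero_constant[of UNIV \<phi>] by auto
    have "cball a r \<noteq> UNIV"
      using bounded_cball[of a r] not_bounded_UNIV by metis
    then obtain x where "x \<notin> cball a r" by blast
    then have "\<phi> x = 0" using \<open>{x. \<phi> x \<noteq> 0} \<subseteq> cball a r\<close> by auto
    moreover have "\<phi> a \<noteq> 0" using r by (simp add: \<phi>_def q flat_exp_def)
    ultimately show False using c[of x] c[of a] by simp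
  qed
  then show ?thesis using C by blast
qed

section \<open>The space of pairs (u, grad u)\<close>

text \<open>From \<open>(a + b)^2 <= 2 a^2 + 2 b^2\<close>. The factor 2 is harmless for limits and
  for finiteness, and replaces Minkowski's inequality.\<close>

lemma L2d_add_le:
  fixes g1 g2 h1 h2 :: "(real^'m::finite) \<Rightarrow> 'b::euclidean_space"
  assumes [measurable]: "g1 \<in> borel_measurable lborel" "g2 \<in> borel_measurable lborel"
    "h1 \<in> borel_measurable lborel" "h2 \<in> borel_measurable lborel"
  shows "L2d (\<lambda>x. g1 x + g2 x) (\<lambda>x. h1 x + h2 x) \<le> 2 * L2d g1 h1 + 2 * L2d g2 h2"
proof -
  have "(norm (g1 x + g2 x - (h1 x + h2 x)))\<^sup>2 \<le> 2 * (norm (g1 x - h1 x))\<^sup>2 + 2 * (norm (g2 x - h2 x))\<^sup>2" for x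
  proof -
    have "norm (g1 x + g2 x - (h1 x + h2 x)) \<le> norm (g1 x - h1 x) + norm (g2 x - h2 x)"
      by (metis add_diff_add norm_triangle_ineq)
    then have "(norm (g1 x + g2 x - (h1 x + h2 x)))\<^sup>2 \<le> (norm (g1 x - h1 x) + norm (g2 x - h2 x))\<^sup>2"
      by (intro power_mono) auto
    also have "\<dots> \<le> 2 * (norm (g1 x - h1 x))\<^sup>2 + 2 * (norm (g2 x - h2 x))\<^sup>2"
      using sum_squares_bound[of "norm (g1 x - h1 x)" "norm (g2 x - h2 x)"] by (simp add: power2_sum)
    finally show ?thesis .
  qed
  then have "L2d (\<lambda>x. g1 x + g2 x) (\<lambda>x. h1 x + h2 x)
      \<le> (\<integral>\<^sup>+ x. 2 * ennreal ((norm (g1 x - h1 x))\<^sup>2) + 2 * ennreal ((norm (g2 x - h2 x))\<^sup>2) \<partial>lborel)"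
    unfolding L2d_def by (intro nn_integral_mono) (simp add: ennreal_leI flip: ennreal_plus ennreal_numeral ennreal_mult)
  also have "\<dots> = 2 * L2d g1 h1 + 2 * L2d g2 h2"
    unfolding L2d_def by (simp add: nn_integral_add nn_integral_cmult)
  finally show ?thesis .
qed

lemma L2d_scale:
  fixes g h :: "(real^'m::finite) \<Rightarrow> 'b::euclidean_space"
  assumes [measurable]: "g \<in> borel_measurable lborel" "h \<in> borel_measurable lborel"
  shows "L2d (\<lambda>x. c *\<^sub>R g x) (\<lambda>x. c *\<^sub>R h x) = ennreal (c\<^sup>2) * L2d g h"
proof -
  have "(norm (c *\<^sub>R g x - c *\<^sub>R h x))\<^sup>2 = c\<^sup>2 * (norm (g x - h x))\<^sup>2" for x
    by (simp add: power_mult_distrib flip: scaleR_right_diff_distrib)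
  then show ?thesis
    unfolding L2d_def by (simp add: ennreal_mult nn_integral_cmult)
qed

lemma L2d_add_tendsto_0:
  fixes h1 h2 :: "(real^'m::finite) \<Rightarrow> 'b::euclidean_space"
  assumes "\<And>k. g1 k \<in> borel_measurable lborel" "\<And>k. g2 k \<in> borel_measurable lborel"
    "h1 \<in> borel_measurable lborel" "h2 \<in> borel_measurable lborel"
    "(\<lambda>k. L2d (g1 k) h1) \<longlonglongrightarrow> 0" "(\<lambda>k. L2d (g2 k) h2) \<longlonglongrightarrow> 0"
  shows "(\<lambda>k. L2d (\<lambda>x. g1 k x + g2 k x) (\<lambda>x. h1 x + h2 x)) \<longlonglongrightarrow> 0"
proof (rule tendsto_sandwich[where f = "\<lambda>_. 0"])
  show "(\<lambda>k. 2 * L2d (g1 k) h1 + 2 * L2d (g2 k) h2) \<longlonglongrightarrow> 0"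
    using tendsto_add[OF ennreal_tendsto_cmult[OF _ assms(5), of 2] ennreal_tendsto_cmult[OF _ assms(6), of 2]]
    by simp
  show "\<forall>\<^sub>F k in sequentially. L2d (\<lambda>x. g1 k x + g2 k x) (\<lambda>x. h1 x + h2 x) \<le> 2 * L2d (g1 k) h1 + 2 * L2d (g2 k) h2"
    using L2d_add_le[OF assms(1,2,3,4)] by simp
qed auto

lemma L2d_scale_tendsto_0:
  fixes h :: "(real^'m::finite) \<Rightarrow> 'b::euclidean_space"
  assumes "\<And>k. g k \<in> borel_measurable lborel" "h \<in> borel_measurable lborel"
    "(\<lambda>k. L2d (g k) h) \<longlonglongrightarrow> 0"
  shows "(\<lambda>k. L2d (\<lambda>x. c *\<^sub>R g k x) (\<lambda>x. c *\<^sub>R h x)) \<longlonglongrightarrow> 0"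
  using ennreal_tendsto_cmult[OF _ assms(3), of "ennreal (c\<^sup>2)"]
  by (simp add: L2d_scale[OF assms(1,2)])

lemma Ccinf_measurable:
  assumes "\<phi> \<in> Ccinf U"
  shows "\<phi> \<in> borel_measurable lborel" "grad \<phi> \<in> borel_measurable lborel"
  using assms continuous_on_smooth[of \<phi>] continuous_on_grad[of \<phi>]
  by (auto simp: Ccinf_def intro: borel_measurable_continuous_onI)

section \<open>Membership in \<open>H10\<close> and closure under linear operations\<close>

lemma H10E:
  assumes "v \<in> H10 U"
  obtains \<phi> where "fst v \<in> borel_measurable lborel" "snd v \<in> borel_measurable lborel"
    "\<And>k. \<phi> k \<in> Ccinf U" "(\<lambda>k. L2d (\<phi> k) (fst v)) \<longlonglongrightarrow> 0" "(\<lambda>k. L2d (grad (\<phi> k)) (snd v)) \<longlonglongrightarrow> 0"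
  using assms unfolding H10_def by fastforce

lemma H10I:
  assumes "fst v \<in> borel_measurable lborel" "snd v \<in> borel_measurable lborel"
    "\<And>k. \<phi> k \<in> Ccinf U" "(\<lambda>k. L2d (\<phi> k) (fst v)) \<longlonglongrightarrow> 0" "(\<lambda>k. L2d (grad (\<phi> k)) (snd v)) \<longlonglongrightarrow> 0"
  shows "v \<in> H10 U"
  using assms by (cases v) (auto simp: H10_def)

lemma H10_mono: "U \<subseteq> W \<Longrightarrow> H10 U \<subseteq> H10 W"
  using Ccinf_mono[of U W] by (auto elim!: H10E intro!: H10I)

lemma hadd_in_H10:
  assumes "v \<in> H10 U" "w \<in> H10 U"
  shows "hadd v w \<in> H10 U"
proof -
  obtain \<phi> where 1: "fst v \<in> borel_measurable lborel" "snd v \<in> borel_measurable lborel"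
    "\<And>k. \<phi> k \<in> Ccinf U" "(\<lambda>k. L2d (\<phi> k) (fst v)) \<longlonglongrightarrow> 0" "(\<lambda>k. L2d (grad (\<phi> k)) (snd v)) \<longlonglongrightarrow> 0"
    using assms(1) by (rule H10E) blast
  obtain \<psi> where 2: "fst w \<in> borel_measurable lborel" "snd w \<in> borel_measurable lborel"
    "\<And>k. \<psi> k \<in> Ccinf U" "(\<lambda>k. L2d (\<psi> k) (fst w)) \<longlonglongrightarrow> 0" "(\<lambda>k. L2d (grad (\<psi> k)) (snd w)) \<longlonglongrightarrow> 0"
    using assms(2) by (rule H10E) blast
  have g: "grad (\<lambda>x. \<phi> k x + \<psi> k x) = (\<lambda>x. grad (\<phi> k) x + grad (\<psi> k) x)" for k
    using 1(3)[of k] 2(3)[of k] by (auto simp: Ccinf_def grad_add)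
  show ?thesis
  proof (rule H10I[where \<phi> = "\<lambda>k x. \<phi> k x + \<psi> k x"])
    show "(\<lambda>k. L2d (\<lambda>x. \<phi> k x + \<psi> k x) (fst (hadd v w))) \<longlonglongrightarrow> 0"
      unfolding hadd_def fst_conv
      by (rule L2d_add_tendsto_0) (use 1 2 Ccinf_measurable[OF 1(3)] Ccinf_measurable[OF 2(3)] in auto)
    show "(\<lambda>k. L2d (grad (\<lambda>x. \<phi> k x + \<psi> k x)) (snd (hadd v w))) \<longlonglongrightarrow> 0"
      unfolding hadd_def snd_conv g
      by (rule L2d_add_tendsto_0) (use 1 2 Ccinf_measurable[OF 1(3)] Ccinf_measurable[OF 2(3)] in auto)
  qed (use 1 2 in \<open>auto simp: hadd_def intro: Ccinf_add\<close>)
qed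

lemma hscale_in_H10:
  assumes "v \<in> H10 U"
  shows "hscale c v \<in> H10 U"
proof -
  obtain \<phi> where 1: "fst v \<in> borel_measurable lborel" "snd v \<in> borel_measurable lborel"
    "\<And>k. \<phi> k \<in> Ccinf U" "(\<lambda>k. L2d (\<phi> k) (fst v)) \<longlonglongrightarrow> 0" "(\<lambda>k. L2d (grad (\<phi> k)) (snd v)) \<longlonglongrightarrow> 0"
    using assms(1) by (rule H10E) blast
  have g: "grad (\<lambda>x. c * \<phi> k x) = (\<lambda>x. c *\<^sub>R grad (\<phi> k) x)" for k
    using 1(3)[of k] by (auto simp: Ccinf_def grad_cmult)
  show ?thesis
  proof (rule H10I[where \<phi> = "\<lambda>k x. c * \<phi> k x"])
    show "(\<lambda>k. L2d (\<lambda>x. c * \<phi> k x) (fst (hscale c v))) \<longlonglongrightarrow> 0"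
      unfolding hscale_def fst_conv real_scaleR_def[symmetric]
      by (rule L2d_scale_tendsto_0) (use 1 Ccinf_measurable[OF 1(3)] in auto)
    show "(\<lambda>k. L2d (grad (\<lambda>x. c * \<phi> k x)) (snd (hscale c v))) \<longlonglongrightarrow> 0"
      unfolding hscale_def snd_conv g
      by (rule L2d_scale_tendsto_0) (use 1 Ccinf_measurable[OF 1(3)] in auto)
  qed (use 1 in \<open>auto simp: hscale_def intro: Ccinf_cmult\<close>)
qed

lemma Ccinf_in_H10: "\<phi> \<in> Ccinf U \<Longrightarrow> (\<phi>, grad \<phi>) \<in> H10 U"
  by (rule H10I[where \<phi> = "\<lambda>_. \<phi>"]) (auto simp: L2d_def dest: Ccinf_measurable)

lemma hsub_eq_hadd: "hsub v w = hadd v (hscale (-1) w)"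
  by (simp add: hsub_def hadd_def hscale_def)

lemma hsub_in_H10: "v \<in> H10 U \<Longrightarrow> w \<in> H10 U \<Longrightarrow> hsub v w \<in> H10 U"
  by (simp add: hsub_eq_hadd hadd_in_H10 hscale_in_H10)

lemma hlin_Suc: "hlin (Suc n) c b = hadd (hlin n c b) (hscale (c n) (b n))"
  by (simp add: hlin_def hadd_def hscale_def)

lemma zero_in_H10: "(\<lambda>_. 0, \<lambda>_. 0) \<in> H10 U"
proof -
  have "grad (\<lambda>_. 0) x = 0" for x :: "real^'a"
    by (rule grad_eq_0_outside_tsupport) (simp add: tsupport_def)
  then have "grad (\<lambda>_. 0) = (\<lambda>_::real^'a. 0)" by (simp add: fun_eq_iff)
  moreover have "(\<lambda>_. 0) \<in> Ccinf U"
    by (auto simp: Ccinf_def tsupport_def intro!: smooth_alg_imp_smooth smooth_alg.const)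
  ultimately show ?thesis
    using Ccinf_in_H10 by metis
qed

lemma hlin_in_H10: "(\<And>i. i < n \<Longrightarrow> b i \<in> H10 U) \<Longrightarrow> hlin n c b \<in> H10 U"
proof (induction n)
  case 0
  then show ?case by (simp add: hlin_def zero_in_H10)
next
  case (Suc n)
  then show ?case by (simp add: hlin_Suc hadd_in_H10 hscale_in_H10)
qed

text \<open>One test function whose gradient is at squared distance below 1 suffices, because test
  gradients are continuous with compact support.\<close>

lemma H10_square_integrable:
  assumes "v \<in> H10 U"
  shows "integrable lborel (\<lambda>x. (norm (snd v x))\<^sup>2)"
proof -
  obtain \<phi> where v: "fst v \<in> borel_measurable lborel" "snd v \<in> borel_measurable lborel"
    "\<And>k. \<phi> k \<in> Ccinf U" "(\<lambda>k. L2d (\<phi> k) (fst v)) \<longlonglongrightarrow> 0" "(\<lambda>k. L2d (grad (\<phi> k)) (snd v)) \<longlonglongrightarrow> 0"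
    using assms by (rule H10E) blast
  note [measurable] = v(2)
  have "\<forall>\<^sub>F k in sequentially. L2d (grad (\<phi> k)) (snd v) < 1"
    using order_tendstoD(2)[OF v(5), of 1] by simp
  then obtain k where k: "L2d (grad (\<phi> k)) (snd v) < 1"
    by (auto simp: eventually_sequentially)
  let ?g = "grad (\<phi> k)"
  have [measurable]: "?g \<in> borel_measurable lborel" using v(3) Ccinf_measurable by blast
  have fin: "(\<integral>\<^sup>+ x. ennreal ((norm (?g x))\<^sup>2) \<partial>lborel) < \<infinity>"
    using square_integrable_grad[OF v(3)] by (simp add: integrable_iff_bounded)
  \<comment> \<open>Here \<open>0 - snd v\<close> is split into \<open>?g - snd v\<close> and
    \<open>- ?g - 0\<close>.\<close>
  have "(\<integral>\<^sup>+ x. ennreal ((norm (snd v x))\<^sup>2) \<partial>lborel)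
      = L2d (\<lambda>x. ?g x + - ?g x) (\<lambda>x. snd v x + 0)"
    by (simp add: L2d_def)
  also have "\<dots> \<le> 2 * L2d ?g (snd v) + 2 * L2d (\<lambda>x. - ?g x) (\<lambda>x. 0)"
    by (rule L2d_add_le) auto
  also have "\<dots> < \<infinity>"
    using less_trans[OF k, of top] fin by (auto simp: L2d_def ennreal_mult_less_top)
  finally show ?thesis
    by (simp add: integrable_iff_bounded)
qed

text \<open>The approximating gradients vanish off \<open>U\<close>, so the mass of
  \<open>snd v\<close> there is at most each approximation error, hence 0.\<close>

lemma H10_AE_outside:
  assumes "v \<in> H10 U" and [measurable]: "U \<in> sets borel"
  shows "AE x in lborel. x \<notin> U \<longrightarrow> snd v x = 0"
proof -
  obtain \<phi> where v: "fst v \<in> borel_measurable lborel" "snd v \<in> borel_measurable lborel"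
    "\<And>k. \<phi> k \<in> Ccinf U" "(\<lambda>k. L2d (\<phi> k) (fst v)) \<longlonglongrightarrow> 0" "(\<lambda>k. L2d (grad (\<phi> k)) (snd v)) \<longlonglongrightarrow> 0"
    using assms(1) by (rule H10E) blast
  note [measurable] = v(2)
  let ?I = "\<integral>\<^sup>+ x. ennreal ((norm (snd v x))\<^sup>2) * indicator (- U) x \<partial>lborel"
  have "?I \<le> L2d (grad (\<phi> k)) (snd v)" for k
    unfolding L2d_def
  proof (rule nn_integral_mono)
    fix x
    have "grad (\<phi> k) x = 0" if "x \<notin> U"
      using v(3)[of k] that by (intro grad_eq_0_outside_tsupport) (auto simp: Ccinf_def)
    then show "ennreal ((norm (snd v x))\<^sup>2) * indicator (- U) x \<le> ennreal ((norm (grad (\<phi> k) x - snd v x))\<^sup>2)"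
      by (auto simp: indicator_def)
  qed
  then have "?I \<le> 0"
    by (intro LIMSEQ_le_const[OF v(5)]) auto
  then have "?I = 0" by simp
  then have "AE x in lborel. ennreal ((norm (snd v x))\<^sup>2) * indicator (- U) x = 0"
    by (subst (asm) nn_integral_0_iff_AE) auto
  then show ?thesis
    by eventually_elim (auto simp: indicator_def split: if_splits)
qed

lemma H10_integrable_inner:
  assumes "v \<in> H10 U" "w \<in> H10 U"
  shows "integrable lborel (\<lambda>x. snd v x \<bullet> snd w x)"
proof (rule Bochner_Integration.integrable_bound)
  show "integrable lborel (\<lambda>x. (norm (snd v x))\<^sup>2 + (norm (snd w x))\<^sup>2)"
    using assms by (intro Bochner_Integration.integrable_add H10_square_integrable)
  have [measurable]: "snd v \<in> borel_measurable lborel" "snd w \<in> borel_measurable lborel"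
    using assms by (auto elim: H10E)
  show "(\<lambda>x. snd v x \<bullet> snd w x) \<in> borel_measurable lborel" by measurable
  have "\<bar>snd v x \<bullet> snd w x\<bar> \<le> (norm (snd v x))\<^sup>2 + (norm (snd w x))\<^sup>2" for x
    using Cauchy_Schwarz_ineq2[of "snd v x" "snd w x"] sum_squares_bound[of "norm (snd v x)" "norm (snd w x)"]
      mult_nonneg_nonneg[OF norm_ge_zero norm_ge_zero, of "snd v x" "snd w x"]
    by linarith
  then show "AE x in lborel. norm (snd v x \<bullet> snd w x) \<le> norm ((norm (snd v x))\<^sup>2 + (norm (snd w x))\<^sup>2)"
    by simp
qed

section \<open>The gradient inner product\<close>

lemma hip_commute: "hip v w = hip w v"
  by (simp add: hip_def inner_commute)

lemma hip_hadd_left: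
  "u \<in> H10 U \<Longrightarrow> v \<in> H10 U \<Longrightarrow> w \<in> H10 U \<Longrightarrow> hip (hadd u v) w = hip u w + hip v w"
  by (simp add: hip_def hadd_def inner_add_left H10_integrable_inner)

lemma hip_hscale_left: "hip (hscale c v) w = c * hip v w"
  by (simp add: hip_def hscale_def)

lemma hip_nonneg: "0 \<le> hip v v"
  by (simp add: hip_def)

lemma hip_hsub_left:
  "u \<in> H10 U \<Longrightarrow> v \<in> H10 U \<Longrightarrow> w \<in> H10 U \<Longrightarrow> hip (hsub u v) w = hip u w - hip v w"
  by (simp add: hsub_eq_hadd hip_hadd_left hscale_in_H10 hip_hscale_left)

lemma hip_hsub_right:
  "u \<in> H10 U \<Longrightarrow> v \<in> H10 U \<Longrightarrow> w \<in> H10 U \<Longrightarrow> hip w (hsub u v) = hip w u - hip w v"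
  using hip_hsub_left by (simp add: hip_commute[of w])

lemma hip_hlin_left:
  "(\<And>i. i < n \<Longrightarrow> b i \<in> H10 U) \<Longrightarrow> w \<in> H10 U \<Longrightarrow> hip (hlin n c b) w = (\<Sum>i<n. c i * hip (b i) w)"
proof (induction n)
  case 0
  then show ?case by (simp add: hlin_def hip_def)
next
  case (Suc n)
  then show ?case
    by (simp add: hlin_Suc hip_hadd_left[where U = U] hlin_in_H10 hscale_in_H10 hip_hscale_left)
qed

lemma hnorm_nonneg: "0 \<le> hnorm v"
  by (simp add: hnorm_def hip_nonneg)

lemma hnorm_power2: "(hnorm v)\<^sup>2 = hip v v"
  by (simp add: hnorm_def hip_nonneg)

lemma hnorm_hscale: "hnorm (hscale c v) = \<bar>c\<bar> * hnorm v"
  using hip_commute[of v "hscale c v"]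
  by (simp add: hnorm_def hip_hscale_left real_sqrt_mult flip: power2_eq_square mult.assoc)

lemma hip_hsub_self:
  assumes "v \<in> H10 U" "w \<in> H10 U"
  shows "hip (hsub v w) (hsub v w) = hip v v - 2 * hip v w + hip w w"
  using assms hsub_in_H10[OF assms]
  by (simp add: hip_hsub_left[where U = U] hip_hsub_right[where U = U] hip_commute[of w v])

text \<open>Expand the square of \<open>s v - t w\<close> and choose \<open>s\<close> and
  \<open>t\<close>. Distinct pairs may be at distance zero, so a vanishing norm gets its own
  argument.\<close>

lemma hip_Cauchy_Schwarz:
  assumes "v \<in> H10 U" "w \<in> H10 U"
  shows "hip v w \<le> hnorm v * hnorm w"
proof -
  have *: "0 \<le> s\<^sup>2 * hip v v - 2 * (s * t) * hip v w + t\<^sup>2 * hip w w" for s t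
  proof -
    have "0 \<le> hip (hsub (hscale s v) (hscale t w)) (hsub (hscale s v) (hscale t w))"
      by (rule hip_nonneg)
    also have "\<dots> = s\<^sup>2 * hip v v - 2 * (s * t) * hip v w + t\<^sup>2 * hip w w"
      using assms hip_commute[of v "hscale s v"] hip_commute[of w "hscale t w"] hip_commute[of v "hscale t w"]
      by (simp add: hip_hsub_self[where U = U] hscale_in_H10 hip_hscale_left power2_eq_square hip_commute[of w v])
    finally show ?thesis .
  qed
  show ?thesis
  proof (cases "hnorm v = 0 \<or> hnorm w = 0")
    case False
    then have pos: "0 < hnorm v" "0 < hnorm w" using hnorm_nonneg[of v] hnorm_nonneg[of w] by linarith+
    \<comment> \<open>The choice is \<open>s = hnorm w\<close> and
      \<open>t = hnorm v\<close>.\<close>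
    have "0 \<le> 2 * ((hnorm v * hnorm w) * (hnorm v * hnorm w - hip v w))"
      using *[of "hnorm w" "hnorm v"]
      by (simp add: hnorm_power2[symmetric] power2_eq_square algebra_simps)
    then have "0 \<le> (hnorm v * hnorm w) * (hnorm v * hnorm w - hip v w)" by simp
    then show ?thesis
      using mult_pos_pos[OF pos] by (simp only: zero_le_mult_iff) linarith
  next
    case True
    show ?thesis
    proof (rule ccontr)
      assume "\<not> ?thesis"
      then have h: "0 < hip v w" using True by auto
      from True show False
      proof
        assume "hnorm v = 0"
        then have v: "hip v v = 0" by (simp add: hnorm_def)
        \<comment> \<open>For \<open>hip v v = 0\<close> the expression is affine in
          \<open>s\<close>; this \<open>s\<close> gives it the value
          \<open>- hip w w - 2\<close>.\<close>
        show False
          using *[of "(hip w w + 1) / hip v w" 1] h hip_nonneg[of w] by (simp add: v)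
      next
        assume "hnorm w = 0"
        then have w: "hip w w = 0" by (simp add: hnorm_def)
        show False
          using *[of 1 "(hip v v + 1) / hip v w"] h hip_nonneg[of v] by (simp add: w)
      qed
    qed
  qed
qed

text \<open>The gradient of a bump is continuous, so where it is nonzero at one point it is nonzero
  on an open set, which is not negligible.\<close>

lemma exists_H10_pos:
  fixes U :: "(real^'m::finite) set"
  assumes "open U" "U \<noteq> {}"
  shows "\<exists>v\<in>H10 U. 0 < hnorm v"
proof -
  obtain \<phi> x where \<phi>: "\<phi> \<in> Ccinf U" "grad \<phi> x \<noteq> 0"
    using exists_bump[OF assms] by blast
  let ?v = "(\<phi>, grad \<phi>)"
  have H: "?v \<in> H10 U" using \<phi> by (simp add: Ccinf_in_H10)
  have "hip ?v ?v \<noteq> 0"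
  proof
    assume "hip ?v ?v = 0"
    then have "AE x in lborel. grad \<phi> x \<bullet> grad \<phi> x = 0"
      using H10_integrable_inner[OF H H] unfolding hip_def
      by (subst (asm) integral_nonneg_eq_0_iff_AE) auto
    then have "AE x in lborel. x \<notin> {x. grad \<phi> x \<noteq> 0}" by simp
    moreover have op: "open {x. grad \<phi> x \<noteq> 0}"
      using \<phi> continuous_on_grad[of \<phi>] by (auto simp: Ccinf_def intro!: open_Collect_neq)
    ultimately have "{x. grad \<phi> x \<noteq> 0} \<in> null_sets lborel"
      by (subst (asm) AE_iff_null_sets[symmetric]) auto
    then have "negligible {x. grad \<phi> x \<noteq> 0}"
      using negligible_iff_null_sets null_sets_completionI by blast
    then show False
      using open_not_negligible[OF op] \<phi>(2) by blast
  qed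
  then have "0 < hnorm ?v"
    using hip_nonneg[of ?v] by (simp add: hnorm_def)
  then show ?thesis using H by blast
qed

section \<open>Orthonormal systems and greedy approximation\<close>

definition orthonormal_upto :: "(real^'m::finite) set \<Rightarrow> (nat \<Rightarrow> 'm h1) \<Rightarrow> nat \<Rightarrow> bool" where
  "orthonormal_upto U b n \<longleftrightarrow>
     (\<forall>i<n. b i \<in> H10 U) \<and> (\<forall>i<n. \<forall>j<n. hip (b i) (b j) = (if i = j then 1 else 0))"

text \<open>For orthonormal \<open>b\<close> this is the error of the orthogonal projection onto the
  span of the first \<open>n\<close> elements. The explicit Fourier sum is easier to handle than
  \<open>proj\<close>, which is a choice.\<close>

definition residual :: "(nat \<Rightarrow> 'm::finite h1) \<Rightarrow> nat \<Rightarrow> 'm h1 \<Rightarrow> 'm h1" where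
  "residual b n w = hsub w (hlin n (\<lambda>i. hip w (b i)) b)"

lemma residual_in_H10: "orthonormal_upto U b n \<Longrightarrow> w \<in> H10 U \<Longrightarrow> residual b n w \<in> H10 U"
  by (simp add: residual_def orthonormal_upto_def hsub_in_H10 hlin_in_H10)

text \<open>Serves the recursive choice in the greedy selection, where step \<open>n\<close> may
  only see the elements before \<open>n\<close>.\<close>

lemma residual_cong: "(\<And>i. i < n \<Longrightarrow> b i = b' i) \<Longrightarrow> residual b n w = residual b' n w"
  by (simp add: residual_def hlin_def)

lemma hip_hlin_orthonormal:
  assumes "orthonormal_upto U b n" "i < n"
  shows "hip (hlin n c b) (b i) = c i"
proof -
  have "hip (hlin n c b) (b i) = (\<Sum>k<n. c k * hip (b k) (b i))"
    using assms by (intro hip_hlin_left[where U = U]) (auto simp: orthonormal_upto_def)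
  also have "\<dots> = (\<Sum>k<n. if k = i then c k else 0)"
    using assms by (intro sum.cong) (auto simp: orthonormal_upto_def)
  finally show ?thesis using assms(2) by simp
qed

lemma hip_residual:
  assumes "orthonormal_upto U b n" "w \<in> H10 U" "i < n"
  shows "hip (residual b n w) (b i) = 0"
  using assms hip_hlin_orthonormal[OF assms(1,3)]
  by (simp add: residual_def hip_hsub_left[where U = U] hlin_in_H10 orthonormal_upto_def)

text \<open>Bessel's identity (with \<open>c i = hip w (b i)\<close>) and the best approximation
  property are both read off from this expansion.\<close>

lemma hip_hsub_hlin:
  assumes "orthonormal_upto U b n" "w \<in> H10 U"
  shows "hip (hsub w (hlin n c b)) (hsub w (hlin n c b))
       = hip w w - 2 * (\<Sum>i<n. c i * hip w (b i)) + (\<Sum>i<n. (c i)\<^sup>2)"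
proof -
  have b: "\<And>i. i < n \<Longrightarrow> b i \<in> H10 U" using assms by (auto simp: orthonormal_upto_def)
  have l: "hlin n c b \<in> H10 U" using b by (rule hlin_in_H10)
  have "hip (hlin n c b) (hlin n c b) = (\<Sum>i<n. c i * hip (b i) (hlin n c b))"
    using b l by (rule hip_hlin_left)
  also have "\<dots> = (\<Sum>i<n. (c i)\<^sup>2)"
    using hip_hlin_orthonormal[OF assms(1)]
    by (intro sum.cong) (auto simp: hip_commute[of "b _" "hlin n c b"] power2_eq_square)
  finally have 1: "hip (hlin n c b) (hlin n c b) = (\<Sum>i<n. (c i)\<^sup>2)" .
  have 2: "hip w (hlin n c b) = (\<Sum>i<n. c i * hip w (b i))"
    using hip_hlin_left[where b = b and n = n and c = c, OF b assms(2)] by (simp add: hip_commute[of w])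
  show ?thesis
    by (simp add: hip_hsub_self[OF assms(2) l] 1 2)
qed

lemma hip_residual_self:
  assumes "orthonormal_upto U b n" "w \<in> H10 U"
  shows "hip (residual b n w) (residual b n w) = hip w w - (\<Sum>i<n. (hip w (b i))\<^sup>2)"
  unfolding residual_def by (simp add: hip_hsub_hlin[OF assms] power2_eq_square)

text \<open>Completing the square: the squared norms differ by the sum of
  \<open>(hip w (b i) - c i)^2\<close>.\<close>

lemma hnorm_residual_le:
  assumes "orthonormal_upto U b n" "w \<in> H10 U"
  shows "hnorm (residual b n w) \<le> hnorm (hsub w (hlin n c b))"
proof -
  have "0 \<le> (\<Sum>i<n. (hip w (b i) - c i)\<^sup>2)" by (simp add: sum_nonneg)
  also have "\<dots> = (\<Sum>i<n. (hip w (b i))\<^sup>2) - 2 * (\<Sum>i<n. c i * hip w (b i)) + (\<Sum>i<n. (c i)\<^sup>2)"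
    by (simp add: power2_diff sum.distrib sum_subtractf sum_distrib_left algebra_simps)
  finally show ?thesis
    unfolding hnorm_def by (simp add: hip_residual_self[OF assms] hip_hsub_hlin[OF assms])
qed

lemma hnorm_residual_antimono:
  assumes "orthonormal_upto U b n" "w \<in> H10 U" "m \<le> n"
  shows "hnorm (residual b n w) \<le> hnorm (residual b m w)"
proof -
  have "orthonormal_upto U b m" using assms by (auto simp: orthonormal_upto_def)
  moreover have "(\<Sum>i<m. (hip w (b i))\<^sup>2) \<le> (\<Sum>i<n. (hip w (b i))\<^sup>2)"
    using assms(3) by (intro sum_mono2) auto
  ultimately show ?thesis
    using assms by (simp add: hnorm_def hip_residual_self)
qed

text \<open>Every candidate for \<open>proj\<close> is some \<open>hlin n c b\<close>, and
  orthogonality to each \<open>b i\<close> forces \<open>c i = hip w (b i)\<close>. The equality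
  thus holds between functions and not merely almost everywhere.\<close>

lemma hsub_proj_orthonormal:
  assumes "orthonormal_upto U b n" "w \<in> H10 U"
  shows "hsub w (proj {hlin n c b | c. True} w) = residual b n w"
proof -
  let ?V = "{hlin n c b | c. True}" and ?p = "hlin n (\<lambda>i. hip w (b i)) b"
  have b: "\<And>i. i < n \<Longrightarrow> b i \<in> H10 U" using assms by (auto simp: orthonormal_upto_def)
  have "hip (hsub w ?p) v = 0" if "v \<in> ?V" for v
  proof -
    from that obtain c where v: "v = hlin n c b" by blast
    have "hip v (residual b n w) = (\<Sum>i<n. c i * hip (b i) (residual b n w))"
      unfolding v using b residual_in_H10[OF assms] by (rule hip_hlin_left)
    also have "\<dots> = 0"
      using hip_residual[OF assms] by (intro sum.neutral) (auto simp: hip_commute[of "b _"])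
    finally show ?thesis by (simp add: residual_def hip_commute)
  qed
  \<comment> \<open>The Fourier sum witnesses existence, so the choice in \<open>proj\<close> has
    its defining property.\<close>
  then have "\<exists>p. p \<in> ?V \<and> (\<forall>v\<in>?V. hip (hsub w p) v = 0)" by blast
  then have "proj ?V w \<in> ?V \<and> (\<forall>v\<in>?V. hip (hsub w (proj ?V w)) v = 0)"
    unfolding proj_def by (rule someI_ex)
  then have P: "proj ?V w \<in> ?V" "\<forall>v\<in>?V. hip (hsub w (proj ?V w)) v = 0"
    by blast+
  then obtain c where c: "proj ?V w = hlin n c b" by blast
  have "c i = hip w (b i)" if i: "i < n" for i
  proof -
    have "b i = hlin n (\<lambda>k. if k = i then 1 else 0) b"
      using i by (simp add: hlin_def if_distrib[of "\<lambda>x. x * _"] if_distrib[of "\<lambda>x. x *\<^sub>R _"] cong: if_cong)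
    then have "b i \<in> ?V" by blast
    then have "hip (hsub w (hlin n c b)) (b i) = 0" using P(2) unfolding c by blast
    then show ?thesis
      using hip_hlin_orthonormal[OF assms(1) i, of c] b[OF i] hlin_in_H10[where b = b and n = n and c = c, OF b] assms(2)
      by (simp add: hip_hsub_left[where U = U])
  qed
  then show ?thesis
    unfolding c residual_def by (simp add: hlin_def)
qed

text \<open>Each coefficient is an inner product with \<open>b i\<close>; Cauchy-Schwarz, used for
  \<open>hlin n c b\<close> and for its negative, makes it zero when the norm is zero.\<close>

lemma orthonormal_subspace_dim:
  assumes "orthonormal_upto U b n"
  shows "subspace_dim U {hlin n c b | c. True} n"
proof -
  have "c i = 0" if "hnorm (hlin n c b) = 0" "i < n" for c i
  proof -
    have b: "b i \<in> H10 U" and l: "hlin n c b \<in> H10 U"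
      using assms that by (auto simp: orthonormal_upto_def intro: hlin_in_H10)
    have "hip (hlin n c b) (b i) \<le> 0"
      using hip_Cauchy_Schwarz[OF l b] that by simp
    moreover have "- hip (hlin n c b) (b i) \<le> 0"
      using hip_Cauchy_Schwarz[OF hscale_in_H10[OF l, of "-1"] b] that
      by (simp add: hip_hscale_left hnorm_hscale)
    ultimately show ?thesis
      using hip_hlin_orthonormal[OF assms that(2), of c] by simp
  qed
  then show ?thesis
    using assms unfolding subspace_dim_def by (intro exI[of _ b]) (auto simp: orthonormal_upto_def)
qed

section \<open>Infinite dimension of \<open>H10\<close> and the greedy basis\<close>

lemma H10_disjoint_orthogonal:
  assumes "v \<in> H10 U" "w \<in> H10 W" "U \<in> sets borel" "W \<in> sets borel" "U \<inter> W = {}"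
  shows "hip v w = 0"
proof -
  have "AE x in lborel. snd v x \<bullet> snd w x = 0"
    using H10_AE_outside[OF assms(1,3)] H10_AE_outside[OF assms(2,4)]
    by eventually_elim (use assms(5) in auto)
  then show ?thesis
    unfolding hip_def by (rule integral_eq_zero_AE)
qed

text \<open>Infinitely many disjoint slices of a ball each carry an element of positive norm;
  disjointness gives orthogonality.\<close>

lemma exists_orthonormal_sequence:
  fixes U :: "(real^'m::finite) set"
  assumes "open U" "U \<noteq> {}"
  shows "\<exists>\<psi>. \<forall>n. orthonormal_upto U \<psi> n"
proof -
  obtain a r where r: "0 < r" "ball a r \<subseteq> U"
    using assms open_contains_ball by blast
  define e :: "real^'m" where "e = axis undefined 1"
  have e: "e \<bullet> e = 1" by (simp add: e_def inner_axis_axis)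
  \<comment> \<open>Parallel slabs cut out by the coordinate along \<open>e\<close>; each slice
    contains a point \<open>a + s e\<close> with \<open>0 < s < r\<close>.\<close>
  define W where "W k = ball a r \<inter> {x. r / real (k + 3) < (x - a) \<bullet> e \<and> (x - a) \<bullet> e < r / real (k + 2)}" for k
  have "open (W k)" for k
    unfolding W_def by (intro open_Int open_Collect_conj open_Collect_less continuous_intros) auto
  moreover have "W k \<noteq> {}" for k
  proof -
    obtain s where s: "r / real (k + 3) < s" "s < r / real (k + 2)"
      using dense[of "r / real (k + 3)" "r / real (k + 2)"] r by (auto simp: divide_strict_left_mono)
    have "r / real (k + 2) \<le> r" "0 < r / real (k + 3)" using r by (auto simp: field_simps)
    then have "0 < s" "s < r" using s by linarith+
    moreover have "norm e = 1" using e by (simp add: norm_eq_sqrt_inner)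
    ultimately have "a + s *\<^sub>R e \<in> W k"
      using s e by (simp add: W_def dist_norm)
    then show ?thesis by blast
  qed
  ultimately have "\<forall>k. \<exists>v\<in>H10 (W k). 0 < hnorm v" using exists_H10_pos by blast
  then obtain v where v: "\<And>k. v k \<in> H10 (W k)" "\<And>k. 0 < hnorm (v k)" by metis
  define \<psi> where "\<psi> k = hscale (1 / hnorm (v k)) (v k)" for k
  have \<psi>: "\<psi> k \<in> H10 (W k)" for k using v by (simp add: \<psi>_def hscale_in_H10)
  have 1: "hip (\<psi> k) (\<psi> k) = 1" for k
    using v(2)[of k] hnorm_power2[of "\<psi> k"] by (simp add: \<psi>_def hnorm_hscale)
  have disj: "W i \<inter> W k = {}" if "i < k" for i k
  proof -
    \<comment> \<open>For \<open>i < k\<close> one has \<open>i + 3 \<le> k + 2\<close>, so slab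
      \<open>k\<close> ends before slab \<open>i\<close> begins.\<close>
    have "r / real (k + 2) \<le> r / real (i + 3)"
      using r that by (intro divide_left_mono) auto
    then show ?thesis by (fastforce simp: W_def)
  qed
  have 0: "hip (\<psi> i) (\<psi> k) = 0" if "i \<noteq> k" for i k
  proof -
    have "W i \<inter> W k = {}" using that disj[of i k] disj[of k i] by (cases "i < k") auto
    then show ?thesis
      using \<psi> \<open>\<And>k. open (W k)\<close> by (intro H10_disjoint_orthogonal[of _ "W i" _ "W k"]) auto
  qed
  have "\<psi> k \<in> H10 U" for k
    using \<psi>[of k] H10_mono[of "W k" U] r by (auto simp: W_def)
  then show ?thesis
    using 0 1 by (intro exI[of _ \<psi>]) (auto simp: orthonormal_upto_def)
qed

text \<open>By Bessel's inequality, n orthonormal vectors cannot capture n + 1 orthonormal ones.\<close>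

lemma exists_outside_span:
  fixes U :: "(real^'m::finite) set"
  assumes "open U" "U \<noteq> {}" and b: "orthonormal_upto U b n"
  shows "\<exists>v\<in>H10 U. 0 < hnorm (residual b n v)"
proof (rule ccontr)
  assume neg: "\<not> ?thesis"
  obtain \<psi> where \<psi>: "\<And>n. orthonormal_upto U \<psi> n"
    using exists_orthonormal_sequence[OF assms(1,2)] by blast
  have \<psi>H: "\<psi> i \<in> H10 U" and \<psi>1: "hip (\<psi> i) (\<psi> i) = 1" for i
    using \<psi>[of "Suc i"] by (auto simp: orthonormal_upto_def)
  have "(\<Sum>k<n. (hip (\<psi> i) (b k))\<^sup>2) = 1" for i
  proof -
    have "hnorm (residual b n (\<psi> i)) = 0"
      using neg \<psi>H[of i] hnorm_nonneg[of "residual b n (\<psi> i)"]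
      by (simp add: order_le_less)
    then show ?thesis
      using hip_residual_self[OF b \<psi>H[of i]] \<psi>1[of i] by (simp add: hnorm_def)
  qed
  \<comment> \<open>Double counting of squared coefficients: summed over \<open>k\<close> first they
    give \<open>n + 1\<close>, summed over \<open>i\<close> first Bessel gives at most
    \<open>n\<close>.\<close>
  then have "real (Suc n) = (\<Sum>i<Suc n. \<Sum>k<n. (hip (\<psi> i) (b k))\<^sup>2)" by simp
  also have "\<dots> = (\<Sum>k<n. \<Sum>i<Suc n. (hip (b k) (\<psi> i))\<^sup>2)"
    by (subst sum.swap) (simp add: hip_commute)
  also have "\<dots> \<le> (\<Sum>k<n. 1)"
  proof (rule sum_mono)
    fix k assume "k \<in> {..<n}"
    then have bk: "b k \<in> H10 U" "hip (b k) (b k) = 1" using b by (auto simp: orthonormal_upto_def)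
    then show "(\<Sum>i<Suc n. (hip (b k) (\<psi> i))\<^sup>2) \<le> 1"
      using hip_residual_self[OF \<psi> bk(1), of "Suc n"] hip_nonneg[of "residual \<psi> (Suc n) (b k)"] by simp
  qed
  finally show False by simp
qed

text \<open>Once all residuals of \<open>A\<close> have norm zero, arbitrary vectors outside the
  span are added, so that every dimension is still reached. \<open>bound\<close> makes the suprema
  finite; \<open>tb\<close> excludes a persistent error.\<close>

lemma orthonormal_greedy:
  fixes U :: "(real^'m::finite) set"
  assumes U: "open U" "U \<noteq> {}" and A: "A \<subseteq> H10 U" and bound: "\<And>a. a \<in> A \<Longrightarrow> hnorm a \<le> C"
    and tb: "\<And>a \<epsilon>. (\<And>n::nat. a n \<in> A) \<Longrightarrow> 0 < \<epsilon> \<Longrightarrow> \<exists>n k. n < k \<and> hnorm (hsub (a k) (a n)) < \<epsilon>"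
  shows "\<exists>b. (\<forall>n. orthonormal_upto U b n) \<and>
     (\<forall>\<epsilon>>0. \<exists>N. \<forall>n\<ge>N. \<forall>a\<in>A. hnorm (residual b n a) \<le> \<epsilon>)"
proof -
  \<comment> \<open>The greedy rule asks for a maximum only up to the factor 2, since the supremum
    may not be attained.\<close>
  define G where "G b n r a \<longleftrightarrow> 0 < hnorm (residual b n a) \<and>
      r = hscale (1 / hnorm (residual b n a)) (residual b n a) \<and>
      (\<forall>a'\<in>A. hnorm (residual b n a') \<le> 2 * hnorm (residual b n a))" for b n r a
  \<comment> \<open>The greedy rule is demanded only while \<open>A\<close> still has an element
    with nonzero residual norm.\<close>
  define P where "P b n r \<longleftrightarrow> r \<in> H10 U \<and> hip r r = 1 \<and> (\<forall>i<n. hip r (b i) = 0) \<and>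
      ((\<exists>a\<in>A. 0 < hnorm (residual b n a)) \<longrightarrow> (\<exists>a\<in>A. G b n r a))" for b n r
  have ON: "orthonormal_upto U b n" if "\<And>k. k < n \<Longrightarrow> P b k (b k)" for b n
    unfolding orthonormal_upto_def
  proof (intro conjI allI impI)
    fix i j assume "i < n" "j < n"
    then show "hip (b i) (b j) = (if i = j then 1 else 0)"
      using that[of i] that[of j] hip_commute[of "b i" "b j"]
      by (cases i j rule: linorder_cases) (auto simp: P_def)
  qed (use that in \<open>auto simp: P_def\<close>)
  have normalised: "hscale (1 / hnorm (residual b n v)) (residual b n v) \<in> H10 U"
      "hip (hscale (1 / hnorm (residual b n v)) (residual b n v)) (hscale (1 / hnorm (residual b n v)) (residual b n v)) = 1"
      "\<forall>i<n. hip (hscale (1 / hnorm (residual b n v)) (residual b n v)) (b i) = 0"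
    if "orthonormal_upto U b n" "v \<in> H10 U" "0 < hnorm (residual b n v)" for b n v
    using that residual_in_H10[OF that(1,2)] hip_residual[OF that(1,2)]
      hnorm_power2[of "hscale (1 / hnorm (residual b n v)) (residual b n v)"]
    by (auto simp: hscale_in_H10 hip_hscale_left hnorm_hscale)
  have "\<exists>b. \<forall>n. P b n (b n)"
  proof (rule dependent_wellorder_choice)
    fix r n and b b' :: "nat \<Rightarrow> 'm h1"
    assume eq: "\<And>k. k < n \<Longrightarrow> b k = b' k"
    then have "residual b n = residual b' n" using residual_cong by blast
    then show "P b n r = P b' n r" using eq by (simp add: P_def G_def)
  next
    fix n and b :: "nat \<Rightarrow> 'm h1"
    assume "\<And>k. k < n \<Longrightarrow> P b k (b k)"
    then have b: "orthonormal_upto U b n" by (rule ON)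
    show "\<exists>r. P b n r"
    proof (cases "\<exists>a\<in>A. 0 < hnorm (residual b n a)")
      case True
      then obtain a0 where a0: "a0 \<in> A" "0 < hnorm (residual b n a0)" by blast
      let ?S = "(\<lambda>a. hnorm (residual b n a)) ` A"
      have "hnorm (residual b n a) \<le> C" if "a \<in> A" for a
      proof -
        have "hnorm (residual b n a) \<le> hnorm (residual b 0 a)"
          using b that A by (intro hnorm_residual_antimono) auto
        \<comment> \<open>With no basis elements the residual is \<open>a\<close> itself, so
          \<open>bound\<close> carries over to every \<open>n\<close>.\<close>
        also have "residual b 0 a = a" by (simp add: residual_def hlin_def hsub_def)
        finally show ?thesis using bound[OF that] by simp
      qed
      then have bdd: "bdd_above ?S" by (intro bdd_aboveI2)
      have up: "hnorm (residual b n a) \<le> Sup ?S" if "a \<in> A" for a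
        using bdd that by (intro cSup_upper) auto
      have "Sup ?S / 2 < Sup ?S" using up[OF a0(1)] a0(2) by linarith
      then obtain a where a: "a \<in> A" "Sup ?S / 2 < hnorm (residual b n a)"
        using less_cSup_iff[OF _ bdd] a0(1) by (metis (no_types, lifting) empty_iff image_iff)
      have pos: "0 < hnorm (residual b n a)" using up[OF a0(1)] a0(2) a(2) by linarith
      have "hnorm (residual b n a') \<le> 2 * hnorm (residual b n a)" if "a' \<in> A" for a'
        using up[OF that] a(2) by linarith
      then have "G b n (hscale (1 / hnorm (residual b n a)) (residual b n a)) a"
        using pos by (simp add: G_def)
      then have "P b n (hscale (1 / hnorm (residual b n a)) (residual b n a))"
        unfolding P_def using normalised[OF b _ pos] a(1) A by blast
      then show ?thesis by blast
    next
      case False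
      obtain v where "v \<in> H10 U" "0 < hnorm (residual b n v)"
        using exists_outside_span[OF U b] by blast
      then have "P b n (hscale (1 / hnorm (residual b n v)) (residual b n v))"
        unfolding P_def using normalised[OF b] False by blast
      then show ?thesis by blast
    qed
  qed
  then obtain b where b: "\<And>n. P b n (b n)" by blast
  then have ob: "orthonormal_upto U b n" for n by (intro ON)
  have "\<exists>N. \<forall>n\<ge>N. \<forall>a\<in>A. hnorm (residual b n a) \<le> \<epsilon>" if "0 < \<epsilon>" for \<epsilon>
  proof (rule ccontr)
    assume neg: "\<not> ?thesis"
    \<comment> \<open>The negation gives large errors at arbitrarily large indices; monotonicity in
      \<open>n\<close> spreads them to every index.\<close>
    have "\<exists>a\<in>A. \<epsilon> < hnorm (residual b n a)" for n
    proof -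
      obtain m a where "n \<le> m" "a \<in> A" "\<epsilon> < hnorm (residual b m a)"
        using neg by (meson not_le)
      then show ?thesis
        using hnorm_residual_antimono[OF ob, of a n m] A by (meson less_le_trans subsetD)
    qed
    then have "\<exists>a\<in>A. G b n (b n) a \<and> \<epsilon> < 2 * hnorm (residual b n a)" for n
      using b[of n] that unfolding P_def by (meson G_def less_le_trans less_trans)
    then obtain a where a: "\<And>n. a n \<in> A" "\<And>n. G b n (b n) (a n)" "\<And>n. \<epsilon> < 2 * hnorm (residual b n (a n))"
      by metis
    obtain n k where nk: "n < k" "hnorm (hsub (a k) (a n)) < \<epsilon> / 2"
      using tb[of a "\<epsilon> / 2"] a(1) \<open>0 < \<epsilon>\<close> by auto
    \<comment> \<open>As \<open>b n\<close> is the normalised residual of \<open>a n\<close>, these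
      are the coordinates of \<open>a n\<close> in \<open>b 0, ..., b n\<close>. Since
      \<open>n < k\<close>, \<open>a n\<close> lies in the span of the first \<open>k\<close>
      elements, so its distance to \<open>a k\<close> is at least the residual norm of
      \<open>a k\<close>, which exceeds \<open>\<epsilon> / 2\<close>.\<close>
    define c where "c i = (if i < n then hip (a n) (b i) else if i = n then hnorm (residual b n (a n)) else 0)" for i
    have "a n = hadd (hlin n (\<lambda>i. hip (a n) (b i)) b) (residual b n (a n))"
      by (simp add: residual_def hadd_def hsub_def)
    also have "residual b n (a n) = hscale (hnorm (residual b n (a n))) (b n)"
    proof -
      let ?h = "hnorm (residual b n (a n))"
      have bn: "b n = hscale (1 / ?h) (residual b n (a n))" and "0 < ?h" using a(2)[of n] by (auto simp: G_def)
      then have "hscale ?h (hscale (1 / ?h) (residual b n (a n))) = residual b n (a n)"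
        by (simp add: hscale_def)
      then show ?thesis using bn by simp
    qed
    also have "hadd (hlin n (\<lambda>i. hip (a n) (b i)) b) (hscale (hnorm (residual b n (a n))) (b n)) = hlin (Suc n) c b"
      unfolding hlin_Suc by (simp add: c_def hlin_def)
    also have "hlin (Suc n) c b = hlin k c b"
    proof -
      have "{..<Suc n} \<subseteq> {..<k}" "\<forall>i\<in>{..<k} - {..<Suc n}. c i = 0" using nk by (auto simp: c_def)
      then show ?thesis
        unfolding hlin_def by (intro prod.inject[THEN iffD2] conjI ext sum.mono_neutral_left) auto
    qed
    finally have "a n = hlin k c b" .
    then have "hnorm (residual b k (a k)) \<le> hnorm (hsub (a k) (a n))"
      using hnorm_residual_le[OF ob, of "a k" k c] a(1)[of k] A by auto
    then show False using a(3)[of k] nk by linarith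
  qed
  then show ?thesis using ob by blast
qed

section \<open>Solutions on a partitioned domain\<close>

lemma H10_set_integrable_inner:
  assumes "v \<in> H10 U" "w \<in> H10 U" "W \<in> sets borel"
  shows "set_integrable lborel W (\<lambda>x. snd v x \<bullet> snd w x)"
  unfolding set_integrable_def using assms
  by (intro integrable_mult_indicator H10_integrable_inner) auto

lemma aU_commute: "aU W v w = aU W w v"
  by (simp add: aU_def inner_commute)

lemma aU_nonneg: "0 \<le> aU W v v"
  by (simp add: aU_def set_lebesgue_integral_def)

lemma aU_hscale: "aU W (hscale c v) w = c * aU W v w"
  by (simp add: aU_def hscale_def)

lemma aU_hsub_self:
  assumes "v \<in> H10 U" "w \<in> H10 U" "W \<in> sets borel"
  shows "aU W (hsub v w) (hsub v w) = aU W v v - 2 * aU W v w + aU W w w"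
proof -
  have "aU W (hsub v w) (hsub v w)
      = (LINT x:W|lborel. snd v x \<bullet> snd v x - (snd v x \<bullet> snd w x + snd v x \<bullet> snd w x) + snd w x \<bullet> snd w x)"
    unfolding aU_def hsub_def
    by (intro arg_cong[where f = "set_lebesgue_integral lborel W"])
       (auto simp: fun_eq_iff inner_diff_left inner_diff_right inner_commute)
  also have "\<dots> = aU W v v - (aU W v w + aU W v w) + aU W w w"
    unfolding aU_def using assms
    by (simp add: set_integral_add set_integral_diff H10_set_integrable_inner)
  finally show ?thesis by simp
qed

lemma aU_eq_0:
  assumes "AE x in lborel. x \<in> W \<longrightarrow> snd v x = 0"
  shows "aU W v w = 0"
  unfolding aU_def set_lebesgue_integral_def
  by (rule integral_eq_zero_AE) (use assms in eventually_elim, auto simp: indicator_def)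

text \<open>A monotone subsequence always exists. An increasing one works at once; a decreasing one
  works from the index on where its values lie within the factor \<open>1 + \<delta>\<close> of
  their infimum.\<close>

lemma almost_monotone_subsequence:
  fixes y :: "nat \<Rightarrow> ereal"
  assumes ge1: "\<And>n. 1 \<le> y n" and "0 < \<delta>"
  shows "\<exists>r::nat \<Rightarrow> nat. strict_mono r \<and> (\<forall>n k. n < k \<longrightarrow> y (r n) \<le> ereal (1 + \<delta>) * y (r k))"
proof -
  have le: "z \<le> ereal (1 + \<delta>) * z" if "1 \<le> z" for z
    using that \<open>0 < \<delta>\<close> by (cases z) auto
  obtain r :: "nat \<Rightarrow> nat" where r: "strict_mono r" "monoseq (\<lambda>n. y (r n))"
    using seq_monosub by blast
  from r(2) consider "\<forall>n. \<forall>k\<ge>n. y (r n) \<le> y (r k)" | "\<forall>n. \<forall>k\<ge>n. y (r k) \<le> y (r n)"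
    by (auto simp: monoseq_def)
  then show ?thesis
  proof cases
    case 1
    have "y (r n) \<le> ereal (1 + \<delta>) * y (r k)" if "n < k" for n k
      using 1 le[OF ge1[of "r k"]] that by (meson less_imp_le order_trans)
    then show ?thesis using r(1) by blast
  next
    case 2
    define L where "L = (INF n. y (r n))"
    have L: "1 \<le> L" "\<And>n. L \<le> y (r n)"
      unfolding L_def by (auto intro: INF_greatest ge1 INF_lower)
    show ?thesis
    \<comment> \<open>\<open>L < (1 + \<delta>) L\<close> fails for an infinite \<open>L\<close>,
      but then the subsequence is constantly infinite.\<close>
    proof (cases "L = \<infinity>")
      case True
      then have "y (r k) = \<infinity>" for k using L(2)[of k] by simp
      then show ?thesis using r(1) \<open>0 < \<delta>\<close> by (intro exI[of _ r]) auto
    next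
      case False
      then have "L < ereal (1 + \<delta>) * L" using L(1) \<open>0 < \<delta>\<close> by (cases L) auto
      then obtain M where M: "y (r M) < ereal (1 + \<delta>) * L"
        unfolding L_def by (auto simp: INF_less_iff)
      have "y (r (n + M)) \<le> ereal (1 + \<delta>) * y (r (k + M))" for n k
      proof -
        have "y (r (n + M)) \<le> y (r M)" using 2 by simp
        also have "\<dots> \<le> ereal (1 + \<delta>) * L" using M by simp
        also have "\<dots> \<le> ereal (1 + \<delta>) * y (r (k + M))"
          using L(2) \<open>0 < \<delta>\<close> by (intro ereal_mult_left_mono) auto
        finally show ?thesis .
      qed
      moreover have "strict_mono (\<lambda>n. r (n + M))"
        using r(1) by (simp add: strict_mono_def)
      ultimately show ?thesis by blast
    qed
  qed
qed

text \<open>One coordinate at a time: the inequality concerns all pairs of indices, so it survives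
  passing to a further subsequence.\<close>

lemma almost_monotone_subsequence_finite:
  fixes y :: "nat \<Rightarrow> nat \<Rightarrow> ereal"
  assumes "\<And>n j. j < d \<Longrightarrow> 1 \<le> y n j" and "0 < \<delta>"
  shows "\<exists>r::nat \<Rightarrow> nat. strict_mono r \<and> (\<forall>j<d. \<forall>n k. n < k \<longrightarrow> y (r n) j \<le> ereal (1 + \<delta>) * y (r k) j)"
  using assms(1)
proof (induction d)
  case 0
  show ?case by (intro exI[of _ "id :: nat \<Rightarrow> nat"]) (auto simp: strict_mono_def)
next
  case (Suc d)
  have "1 \<le> y n j" if "j < d" for n j using Suc.prems[of j n] that by simp
  then have "\<exists>r::nat \<Rightarrow> nat. strict_mono r \<and>
      (\<forall>j<d. \<forall>n k. n < k \<longrightarrow> y (r n) j \<le> ereal (1 + \<delta>) * y (r k) j)"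
    by (rule Suc.IH)
  then obtain r :: "nat \<Rightarrow> nat" where r: "strict_mono r"
    "\<And>j n k. j < d \<Longrightarrow> n < k \<Longrightarrow> y (r n) j \<le> ereal (1 + \<delta>) * y (r k) j"
    by blast
  obtain s :: "nat \<Rightarrow> nat" where s: "strict_mono s"
    "\<And>n k. n < k \<Longrightarrow> y (r (s n)) d \<le> ereal (1 + \<delta>) * y (r (s k)) d"
    using almost_monotone_subsequence[of "\<lambda>n. y (r n) d", OF Suc.prems \<open>0 < \<delta>\<close>] by auto
  have "strict_mono (\<lambda>n. r (s n))" using r(1) s(1) by (simp add: strict_mono_def)
  moreover have "\<forall>j<Suc d. \<forall>n k. n < k \<longrightarrow> y (r (s n)) j \<le> ereal (1 + \<delta>) * y (r (s k)) j"
    using r(2) s by (auto simp: less_Suc_eq strict_mono_def)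
  ultimately show ?case by blast
qed

text \<open>Otherwise every step loses more than \<delta> and the values become negative. One such
  step is enough to refute separation.\<close>

lemma bounded_below_small_decrease:
  fixes x :: "nat \<Rightarrow> real"
  assumes "\<And>n. 0 \<le> x n" "0 < \<delta>"
  shows "\<exists>n. x n - x (Suc n) \<le> \<delta>"
proof (rule ccontr)
  assume neg: "\<not> ?thesis"
  have step: "x (Suc n) \<le> x n - \<delta>" for n
  proof -
    have "\<not> x n - x (Suc n) \<le> \<delta>" using neg by blast
    then show ?thesis by linarith
  qed
  have le: "x n \<le> x 0 - real n * \<delta>" for n
  proof (induction n)
    case (Suc n)
    then show ?case using step[of n] by (simp add: algebra_simps)
  qed simp
  obtain n where "x 0 < real n * \<delta>"
    using reals_Archimedean3[OF \<open>0 < \<delta>\<close>] by blast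
  then show False using assms(1)[of n] le[of n] by linarith
qed

text \<open>The assumption \<open>null\<close> excludes interfaces of positive measure, so that
  \<open>hip\<close> splits into the forms \<open>aU\<close> on the subdomains.\<close>

locale partitioned_domain =
  fixes \<Omega> :: "(real^'m::finite) set" and \<Omega>s :: "nat \<Rightarrow> (real^'m) set" and d :: nat
    and f :: "'m h1 \<Rightarrow> real"
  assumes open_\<Omega>: "open \<Omega>"
    and open_\<Omega>s: "\<And>j. j < d \<Longrightarrow> open (\<Omega>s j)"
    and \<Omega>s_nonempty: "\<And>j. j < d \<Longrightarrow> \<Omega>s j \<noteq> {}"
    and \<Omega>s_subset: "\<And>j. j < d \<Longrightarrow> \<Omega>s j \<subseteq> \<Omega>"
    and \<Omega>s_disjoint: "\<And>i j. i < d \<Longrightarrow> j < d \<Longrightarrow> i \<noteq> j \<Longrightarrow> \<Omega>s i \<inter> \<Omega>s j = {}"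
    and null: "\<Omega> - (\<Union>j<d. \<Omega>s j) \<in> null_sets lborel"
    and f: "Hminus1 \<Omega> f"
begin

section \<open>Energy estimates for the weak equation\<close>

definition infs :: "(nat \<Rightarrow> ereal) \<Rightarrow> nat set" where
  "infs y = {j. j < d \<and> y j = \<infinity>}"

lemma is_uD:
  assumes "is_u \<Omega> \<Omega>s d f y w"
  shows "w \<in> VS \<Omega> \<Omega>s (infs y)"
    and "\<And>v. v \<in> VS \<Omega> \<Omega>s (infs y) \<Longrightarrow>
           (\<Sum>j\<in>{..<d} - infs y. real_of_ereal (y j) * aU (\<Omega>s j) w v) = f v"
    and "w \<in> H10 \<Omega>"
  using assms by (auto simp: is_u_def infs_def Let_def VS_def)

text \<open>Almost every point lies in exactly one subdomain or outside \<open>\<Omega>\<close>,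
  where the gradient vanishes.\<close>

lemma hip_eq_sum_aU:
  assumes "v \<in> H10 \<Omega>" "w \<in> H10 \<Omega>"
  shows "hip v w = (\<Sum>j<d. aU (\<Omega>s j) v w)"
proof -
  have "AE x in lborel. x \<notin> \<Omega> - (\<Union>j<d. \<Omega>s j)"
    using null by (rule AE_not_in)
  moreover have "AE x in lborel. x \<notin> \<Omega> \<longrightarrow> snd v x = 0"
    using H10_AE_outside[OF assms(1)] open_\<Omega> by simp
  ultimately have AE: "AE x in lborel. snd v x \<bullet> snd w x = (\<Sum>j<d. indicator (\<Omega>s j) x *\<^sub>R (snd v x \<bullet> snd w x))"
  proof eventually_elim
    case (elim x)
    show ?case
    proof (cases "x \<in> (\<Union>j<d. \<Omega>s j)")
      case True
      then obtain i where i: "i < d" "x \<in> \<Omega>s i" by blast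
      have "(\<Sum>j<d. indicator (\<Omega>s j) x *\<^sub>R (snd v x \<bullet> snd w x)) = (\<Sum>j<d. if j = i then snd v x \<bullet> snd w x else 0)"
        using i \<Omega>s_disjoint[of i] by (intro sum.cong) (auto simp: indicator_def)
      then show ?thesis using i by simp
    next
      case False
      then have "snd v x = 0" using elim by blast
      then show ?thesis by simp
    qed
  qed
  have int: "integrable lborel (\<lambda>x. indicator (\<Omega>s j) x *\<^sub>R (snd v x \<bullet> snd w x))" if "j < d" for j
    using H10_set_integrable_inner[OF assms, of "\<Omega>s j"] open_\<Omega>s[OF that]
    unfolding set_integrable_def by simp
  have "hip v w = (\<integral>x. (\<Sum>j<d. indicator (\<Omega>s j) x *\<^sub>R (snd v x \<bullet> snd w x)) \<partial>lborel)"
    unfolding hip_def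
  proof (rule integral_cong_AE)
    show "(\<lambda>x. snd v x \<bullet> snd w x) \<in> borel_measurable lborel"
      using H10_integrable_inner[OF assms] by (rule borel_measurable_integrable)
    show "(\<lambda>x. \<Sum>j<d. indicator (\<Omega>s j) x *\<^sub>R (snd v x \<bullet> snd w x)) \<in> borel_measurable lborel"
      using int by (intro borel_measurable_sum borel_measurable_integrable) simp
  qed (rule AE)
  also have "\<dots> = (\<Sum>j<d. aU (\<Omega>s j) v w)"
    unfolding aU_def set_lebesgue_integral_def using int
    by (intro Bochner_Integration.integral_sum) simp
  finally show ?thesis .
qed

lemma aU_eq_0_on_infs: "v \<in> VS \<Omega> \<Omega>s S \<Longrightarrow> j \<in> S \<Longrightarrow> aU (\<Omega>s j) v w = 0"
  by (rule aU_eq_0) (auto simp: VS_def)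

lemma VS_antimono: "S \<subseteq> T \<Longrightarrow> VS \<Omega> \<Omega>s T \<subseteq> VS \<Omega> \<Omega>s S"
  by (auto simp: VS_def)

lemma hsub_in_VS:
  assumes "v \<in> VS \<Omega> \<Omega>s S" "w \<in> VS \<Omega> \<Omega>s S"
  shows "hsub v w \<in> VS \<Omega> \<Omega>s S"
proof -
  have "AE x in lborel. x \<in> \<Omega>s j \<longrightarrow> snd (hsub v w) x = 0" if "j \<in> S" for j
  proof -
    have "AE x in lborel. x \<in> \<Omega>s j \<longrightarrow> snd v x = 0" "AE x in lborel. x \<in> \<Omega>s j \<longrightarrow> snd w x = 0"
      using assms that by (auto simp: VS_def)
    then show ?thesis by eventually_elim (simp add: hsub_def)
  qed
  then show ?thesis using assms by (auto simp: VS_def hsub_in_H10)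
qed

lemma ereal_coefficient_ge_1:
  assumes "\<And>j. j < d \<Longrightarrow> 1 \<le> y j" "j \<in> {..<d} - infs y"
  shows "1 \<le> real_of_ereal (y j)"
  using assms(1)[of j] assms(2) by (cases "y j") (auto simp: infs_def)

text \<open>Coercivity with constant 1: finite coefficients are at least 1, and on the subdomains in
  \<open>infs y\<close> the gradient of \<open>z\<close> vanishes.\<close>

lemma hip_le_energy:
  assumes "\<And>j. j < d \<Longrightarrow> 1 \<le> y j" "z \<in> VS \<Omega> \<Omega>s (infs y)"
  shows "hip z z \<le> (\<Sum>j\<in>{..<d} - infs y. real_of_ereal (y j) * aU (\<Omega>s j) z z)"
proof -
  have "z \<in> H10 \<Omega>" using assms(2) by (simp add: VS_def)
  then have "hip z z = (\<Sum>j<d. aU (\<Omega>s j) z z)" by (simp add: hip_eq_sum_aU)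
  also have "\<dots> = (\<Sum>j\<in>{..<d} - infs y. aU (\<Omega>s j) z z)"
    using aU_eq_0_on_infs[OF assms(2)] by (intro sum.mono_neutral_right) auto
  also have "\<dots> \<le> (\<Sum>j\<in>{..<d} - infs y. real_of_ereal (y j) * aU (\<Omega>s j) z z)"
  proof (rule sum_mono)
    fix j assume "j \<in> {..<d} - infs y"
    then have "1 * aU (\<Omega>s j) z z \<le> real_of_ereal (y j) * aU (\<Omega>s j) z z"
      using ereal_coefficient_ge_1[of y j] assms(1) by (intro mult_right_mono aU_nonneg) auto
    then show "aU (\<Omega>s j) z z \<le> real_of_ereal (y j) * aU (\<Omega>s j) z z" by simp
  qed
  finally show ?thesis .
qed

text \<open>Testing the equation with the solution itself turns its energy into
  \<open>f w\<close>.\<close>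

lemma hip_le_f:
  assumes "is_u \<Omega> \<Omega>s d f y w" "\<And>j. j < d \<Longrightarrow> 1 \<le> y j"
  shows "hip w w \<le> f w"
  using hip_le_energy[OF assms(2) is_uD(1)[OF assms(1)]] is_uD(2)[OF assms(1) is_uD(1)[OF assms(1)]]
  by simp

text \<open>Energy comparison for \<open>y \<le> (1 + \<delta>) y'\<close>: then \<open>w'\<close> is an admissible test function in the
  equation of \<open>w\<close>, since \<open>y j = \<infinity>\<close> forces \<open>y' j = \<infinity>\<close>.\<close>

lemma hip_hsub_le:
  assumes u: "is_u \<Omega> \<Omega>s d f y w" and u': "is_u \<Omega> \<Omega>s d f y' w'"
    and ge1: "\<And>j. j < d \<Longrightarrow> 1 \<le> y j" and ge1': "\<And>j. j < d \<Longrightarrow> 1 \<le> y' j" and "0 < \<delta>"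
    and le: "\<And>j. j < d \<Longrightarrow> y j \<le> ereal (1 + \<delta>) * y' j"
  shows "hip (hsub w w') (hsub w w') \<le> f w - f w' + \<delta> * f w'"
proof -
  have sub: "infs y \<subseteq> infs y'"
    using le ge1' by (force simp: infs_def)
  note w = is_uD[OF u] and w' = is_uD[OF u']
  have w'V: "w' \<in> VS \<Omega> \<Omega>s (infs y)" using VS_antimono[OF sub] w'(1) by blast
  have "hip (hsub w w') (hsub w w')
      \<le> (\<Sum>j\<in>{..<d} - infs y. real_of_ereal (y j) * aU (\<Omega>s j) (hsub w w') (hsub w w'))"
    using hsub_in_VS[OF w(1) w'V] ge1 by (intro hip_le_energy)
  also have "\<dots> = (\<Sum>j\<in>{..<d} - infs y. real_of_ereal (y j) * aU (\<Omega>s j) w w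
       - 2 * (real_of_ereal (y j) * aU (\<Omega>s j) w w') + real_of_ereal (y j) * aU (\<Omega>s j) w' w')"
    using w(3) w'(3) open_\<Omega>s by (intro sum.cong) (auto simp: aU_hsub_self[where U = \<Omega>] algebra_simps)
  \<comment> \<open>Testing with \<open>w\<close> and \<open>w'\<close> evaluates the first two
    sums; what remains is the energy of \<open>w'\<close> with the coefficients of
    \<open>w\<close>.\<close>
  also have "\<dots> = f w - 2 * f w' + (\<Sum>j\<in>{..<d} - infs y. real_of_ereal (y j) * aU (\<Omega>s j) w' w')"
    using w(2)[OF w(1)] w(2)[OF w'V]
    by (simp add: sum.distrib sum_subtractf flip: sum_distrib_left)
  \<comment> \<open>The gradient of \<open>w'\<close> vanishes where \<open>y'\<close> is infinite,
    so coefficients are compared only where both are finite.\<close>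
  also have "(\<Sum>j\<in>{..<d} - infs y. real_of_ereal (y j) * aU (\<Omega>s j) w' w')
      = (\<Sum>j\<in>{..<d} - infs y'. real_of_ereal (y j) * aU (\<Omega>s j) w' w')"
    using sub aU_eq_0_on_infs[OF w'(1)] by (intro sum.mono_neutral_right) auto
  also have "\<dots> \<le> (\<Sum>j\<in>{..<d} - infs y'. (1 + \<delta>) * (real_of_ereal (y' j) * aU (\<Omega>s j) w' w'))"
  proof (rule sum_mono)
    fix j assume j: "j \<in> {..<d} - infs y'"
    then have "1 \<le> y j" "1 \<le> y' j" "y j \<le> ereal (1 + \<delta>) * y' j" "y' j \<noteq> \<infinity>"
      using ge1 ge1' le by (auto simp: infs_def)
    then have "real_of_ereal (y j) \<le> (1 + \<delta>) * real_of_ereal (y' j)"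
      by (cases "y j"; cases "y' j") auto
    then have "real_of_ereal (y j) * aU (\<Omega>s j) w' w' \<le> (1 + \<delta>) * real_of_ereal (y' j) * aU (\<Omega>s j) w' w'"
      by (intro mult_right_mono aU_nonneg)
    then show "real_of_ereal (y j) * aU (\<Omega>s j) w' w' \<le> (1 + \<delta>) * (real_of_ereal (y' j) * aU (\<Omega>s j) w' w')"
      by (simp add: mult.assoc)
  qed
  also have "\<dots> = (1 + \<delta>) * f w'"
    using w'(2)[OF w'(1)] by (simp flip: sum_distrib_left)
  finally show ?thesis by (simp add: algebra_simps)
qed

lemma f_le:
  obtains C where "0 \<le> C" "\<And>v. v \<in> H10 \<Omega> \<Longrightarrow> f v \<le> C * hnorm v"
proof -
  obtain C where C: "\<And>v. v \<in> H10 \<Omega> \<Longrightarrow> \<bar>f v\<bar> \<le> C * hnorm v"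
    using f unfolding Hminus1_def by blast
  \<comment> \<open>\<open>Hminus1\<close> does not say that its constant is nonnegative.\<close>
  have "f v \<le> \<bar>C\<bar> * hnorm v" if "v \<in> H10 \<Omega>" for v
    using C[OF that] mult_right_mono[OF abs_ge_self[of C] hnorm_nonneg[of v]] by linarith
  then show ?thesis using that[of "\<bar>C\<bar>"] by simp
qed

text \<open>As \<open>Sup {}\<close> is unspecified over the reals, this needs a nonzero element of \<open>H10 (\<Omega>s j)\<close>, i.e. a bump function.\<close>

lemma Hm1norm_le_hnorm:
  assumes u: "is_u \<Omega> \<Omega>s d f y w" and j: "j < d" "y j = 1"
  shows "Hm1norm f (\<Omega>s j) \<le> hnorm w"
  unfolding Hm1norm_def
proof (rule cSup_least)
  show "{f \<phi> / hnorm \<phi> |\<phi>. \<phi> \<in> H10 (\<Omega>s j) \<and> hnorm \<phi> \<noteq> 0} \<noteq> {}"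
    using exists_H10_pos[OF open_\<Omega>s \<Omega>s_nonempty, OF j(1) j(1)] by force
next
  fix x assume "x \<in> {f \<phi> / hnorm \<phi> |\<phi>. \<phi> \<in> H10 (\<Omega>s j) \<and> hnorm \<phi> \<noteq> 0}"
  then obtain \<phi> where \<phi>: "\<phi> \<in> H10 (\<Omega>s j)" "hnorm \<phi> \<noteq> 0" and x: "x = f \<phi> / hnorm \<phi>" by blast
  have \<phi>\<Omega>: "\<phi> \<in> H10 \<Omega>" using \<phi>(1) H10_mono[OF \<Omega>s_subset[OF j(1)]] by blast
  have off: "AE x in lborel. x \<in> \<Omega>s i \<longrightarrow> snd \<phi> x = 0" if "i < d" "i \<noteq> j" for i
  proof -
    have "AE x in lborel. x \<notin> \<Omega>s j \<longrightarrow> snd \<phi> x = 0"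
      using H10_AE_outside[OF \<phi>(1)] open_\<Omega>s[OF j(1)] by simp
    then show ?thesis by eventually_elim (use \<Omega>s_disjoint[OF that(1) j(1) that(2)] in blast)
  qed
  \<comment> \<open>As \<open>y j\<close> is finite, membership in \<open>VS\<close> restricts
    \<phi> only on other subdomains, where its gradient vanishes anyway.\<close>
  have jn: "j \<notin> infs y" using j by (simp add: infs_def)
  then have V: "\<phi> \<in> VS \<Omega> \<Omega>s (infs y)"
    using \<phi>\<Omega> off by (auto simp: VS_def infs_def)
  have zero: "aU (\<Omega>s i) w \<phi> = 0" if "i < d" "i \<noteq> j" for i
    using aU_eq_0[OF off[OF that], of w] by (simp add: aU_commute)
  have "f \<phi> = (\<Sum>i\<in>{..<d} - infs y. real_of_ereal (y i) * aU (\<Omega>s i) w \<phi>)"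
    using is_uD(2)[OF u V] by simp
  also have "\<dots> = (\<Sum>i\<in>{j}. real_of_ereal (y i) * aU (\<Omega>s i) w \<phi>)"
    using zero jn j(1) by (intro sum.mono_neutral_right) auto
  \<comment> \<open>The coefficient 1 on subdomain \<open>j\<close> turns the weighted form into the
    full inner product.\<close>
  also have "\<dots> = (\<Sum>i\<in>{j}. aU (\<Omega>s i) w \<phi>)" using j(2) by simp
  also have "\<dots> = (\<Sum>i<d. aU (\<Omega>s i) w \<phi>)"
    using zero j(1) by (intro sum.mono_neutral_left) auto
  also have "\<dots> = hip w \<phi>" using hip_eq_sum_aU[OF is_uD(3)[OF u] \<phi>\<Omega>] by simp
  also have "\<dots> \<le> hnorm w * hnorm \<phi>" using is_uD(3)[OF u] \<phi>\<Omega> by (rule hip_Cauchy_Schwarz)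
  finally show "x \<le> hnorm w"
    using \<phi>(2) hnorm_nonneg[of \<phi>] by (simp add: x divide_le_eq)
qed

text \<open>The factors \<mu> and \<open>1 / \<mu>\<close> cancel in each term, and the set of
  infinite coordinates is unchanged.\<close>

lemma is_u_hscale:
  assumes u: "is_u \<Omega> \<Omega>s d f y w" and "0 < \<mu>" and pos: "\<And>j. j < d \<Longrightarrow> 0 < y j"
  shows "is_u \<Omega> \<Omega>s d f (\<lambda>j. y j / ereal \<mu>) (hscale \<mu> w)"
proof -
  have S: "infs (\<lambda>j. y j / ereal \<mu>) = infs y"
  proof -
    have "y j / ereal \<mu> = \<infinity> \<longleftrightarrow> y j = \<infinity>" if "j < d" for j
      using pos[OF that] \<open>0 < \<mu>\<close> by (cases "y j") auto
    then show ?thesis by (auto simp: infs_def)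
  qed
  have "hscale \<mu> w \<in> VS \<Omega> \<Omega>s (infs y)"
    using is_uD(1)[OF u] hscale_in_H10[of w \<Omega> \<mu>] by (auto simp: VS_def hscale_def)
  moreover have "(\<Sum>j\<in>{..<d} - infs y. real_of_ereal (y j / ereal \<mu>) * aU (\<Omega>s j) (hscale \<mu> w) v)
      = (\<Sum>j\<in>{..<d} - infs y. real_of_ereal (y j) * aU (\<Omega>s j) w v)" for v
  proof (rule sum.cong)
    fix j assume "j \<in> {..<d} - infs y"
    then have "real_of_ereal (y j / ereal \<mu>) = real_of_ereal (y j) / \<mu>"
      using pos[of j] \<open>0 < \<mu>\<close> by (cases "y j") (auto simp: infs_def)
    then show "real_of_ereal (y j / ereal \<mu>) * aU (\<Omega>s j) (hscale \<mu> w) v = real_of_ereal (y j) * aU (\<Omega>s j) w v"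
      using \<open>0 < \<mu>\<close> by (simp add: aU_hscale)
  qed simp
  ultimately show ?thesis
    using is_uD(2)[OF u] S unfolding is_u_def Let_def infs_def[symmetric] by simp
qed

text \<open>The bound \<open>1 \<le> y j\<close> gives coercivity and hence upper bounds; the
  attained value 1 gives the lower bound on the norm.\<close>

definition normalised_solutions :: "'m h1 set" where
  "normalised_solutions =
     {w. \<exists>y. is_u \<Omega> \<Omega>s d f y w \<and> (\<forall>j<d. 1 \<le> y j) \<and> (\<exists>j<d. y j = 1)}"

text \<open>The two indices are consecutive terms of an almost monotone subsequence of parameters,
  taken where \<open>f\<close> decreases by at most \<delta>.\<close>

lemma normalised_solutions_totally_bounded:
  assumes a: "\<And>n::nat. a n \<in> normalised_solutions" and "0 < \<epsilon>"
  shows "\<exists>n k. n < k \<and> hnorm (hsub (a k) (a n)) < \<epsilon>"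
proof -
  obtain y where y: "\<And>n. is_u \<Omega> \<Omega>s d f (y n) (a n)" "\<And>n j. j < d \<Longrightarrow> 1 \<le> y n j"
    using a unfolding normalised_solutions_def mem_Collect_eq by metis
  obtain C where C: "0 \<le> C" "\<And>v. v \<in> H10 \<Omega> \<Longrightarrow> f v \<le> C * hnorm v" using f_le by blast
  have pos: "0 \<le> f (a n)" for n
    using hip_le_f[OF y(1,2)] hip_nonneg order_trans by blast
  \<comment> \<open>Coercivity and continuity of \<open>f\<close> give
    \<open>|a|^2 \<le> f a \<le> C |a|\<close>, hence \<open>|a| \<le> C\<close>.\<close>
  have bd: "f (a n) \<le> C\<^sup>2" for n
  proof -
    have fa: "f (a n) \<le> C * hnorm (a n)" using C(2) is_uD(3)[OF y(1)] by blast
    have "hnorm (a n) * hnorm (a n) \<le> C * hnorm (a n)"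
      using fa hip_le_f[OF y(1,2), of n] hnorm_power2[of "a n"] by (simp add: power2_eq_square)
    then have "hnorm (a n) \<le> C"
      using C(1) hnorm_nonneg[of "a n"] by (cases "hnorm (a n) = 0") (auto simp: mult_le_cancel_right)
    then have "C * hnorm (a n) \<le> C * C" using C(1) by (rule mult_left_mono)
    then show ?thesis using fa by (simp add: power2_eq_square)
  qed
  define K where "K = 1 + C\<^sup>2"
  \<comment> \<open>Chosen so that \<open>\<delta> + \<delta> * C\<^sup>2\<close> is half of
    \<open>\<epsilon>\<^sup>2\<close>, which leaves a strict inequality at the end.\<close>
  define \<delta> where "\<delta> = \<epsilon>\<^sup>2 / (2 * K)"
  have K: "0 < K" unfolding K_def using zero_le_power2[of C] by linarith
  have "\<delta> + \<delta> * C\<^sup>2 = \<delta> * K" by (simp add: K_def algebra_simps)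
  also have "\<dots> = \<epsilon>\<^sup>2 / 2" using K by (simp add: \<delta>_def)
  finally have \<delta>: "0 < \<delta>" "\<delta> + \<delta> * C\<^sup>2 = \<epsilon>\<^sup>2 / 2"
    using \<open>0 < \<epsilon>\<close> K by (auto simp: \<delta>_def)
  obtain r :: "nat \<Rightarrow> nat" where r: "strict_mono r"
    "\<And>j n k. j < d \<Longrightarrow> n < k \<Longrightarrow> y (r n) j \<le> ereal (1 + \<delta>) * y (r k) j"
    using almost_monotone_subsequence_finite[of d y, OF y(2) \<delta>(1)] by blast
  obtain n where n: "f (a (r n)) - f (a (r (Suc n))) \<le> \<delta>"
    using bounded_below_small_decrease[of "\<lambda>n. f (a (r n))", OF pos \<delta>(1)] by blast
  let ?v = "a (r n)" and ?w = "a (r (Suc n))"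
  have H: "?v \<in> H10 \<Omega>" "?w \<in> H10 \<Omega>" using is_uD(3)[OF y(1)] by auto
  have "hip (hsub ?w ?v) (hsub ?w ?v) = hip (hsub ?v ?w) (hsub ?v ?w)"
    using H by (simp add: hip_hsub_self[where U = \<Omega>] hip_commute[of ?w ?v])
  also have "\<dots> \<le> f ?v - f ?w + \<delta> * f ?w"
    using y r(2) \<delta>(1) by (intro hip_hsub_le[of "y (r n)" _ "y (r (Suc n))"]) auto
  also have "\<dots> \<le> \<delta> + \<delta> * C\<^sup>2"
    using n bd[of "r (Suc n)"] \<delta>(1) by (intro add_mono mult_left_mono) auto
  also have "\<dots> < \<epsilon>\<^sup>2" using zero_less_power[OF \<open>0 < \<epsilon>\<close>, of 2] unfolding \<delta>(2) by simp
  finally have "hnorm (hsub ?w ?v) < \<epsilon>"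
    using \<open>0 < \<epsilon>\<close> by (simp add: hnorm_def real_less_lsqrt hip_nonneg)
  moreover have "r n < r (Suc n)" using r(1) by (simp add: strict_mono_def)
  ultimately show ?thesis by blast
qed

lemma normalised_solutions_bounded:
  obtains C where "\<And>a. a \<in> normalised_solutions \<Longrightarrow> hnorm a \<le> C"
proof -
  obtain C where C: "0 \<le> C" "\<And>v. v \<in> H10 \<Omega> \<Longrightarrow> f v \<le> C * hnorm v" using f_le by blast
  have "hnorm a \<le> C" if a: "a \<in> normalised_solutions" for a
  proof -
    obtain y where y: "is_u \<Omega> \<Omega>s d f y a" "\<And>j. j < d \<Longrightarrow> 1 \<le> y j"
      using a unfolding normalised_solutions_def by blast
    have "hnorm a * hnorm a \<le> C * hnorm a"
      using hip_le_f[OF y] C(2)[OF is_uD(3)[OF y(1)]] hnorm_power2[of a] by (simp add: power2_eq_square)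
    then show ?thesis
      using C(1) hnorm_nonneg[of a] by (cases "hnorm a = 0") (auto simp: mult_le_cancel_right)
  qed
  then show ?thesis using that by blast
qed

end

section \<open>Uniform approximation of the solution manifold\<close>

theorem mainTheorem4:
  fixes \<Omega> :: "(real^'m) set" and \<Omega>s :: "nat \<Rightarrow> (real^'m) set" and d :: nat
    and f :: "'m h1 \<Rightarrow> real"
  assumes "open \<Omega>" and "bounded \<Omega>" and "0 < d"
    and "\<forall>j<d. open (\<Omega>s j) \<and> \<Omega>s j \<noteq> {} \<and> \<Omega>s j \<subseteq> \<Omega>"
    and "\<forall>i<d. \<forall>j<d. i \<noteq> j \<longrightarrow> \<Omega>s i \<inter> \<Omega>s j = {}"
    and "(\<Union>j<d. closure (\<Omega>s j)) = closure \<Omega>"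
    and "\<Omega> - (\<Union>j<d. \<Omega>s j) \<in> null_sets lborel"
    and "Hminus1 \<Omega> f"
    and "Min ((\<lambda>j. Hm1norm f (\<Omega>s j)) ` {..<d}) > 0"
  shows "\<exists>V \<epsilon>. (\<forall>n\<ge>1. subspace_dim \<Omega> (V n) n) \<and> (\<forall>n\<ge>1. \<epsilon> n > 0) \<and> \<epsilon> \<longlonglongrightarrow> 0 \<and>
           (\<forall>n\<ge>1. \<forall>y. (\<forall>j<d. 0 < y j) \<longrightarrow>
              (\<forall>w. is_u \<Omega> \<Omega>s d f y w \<longrightarrow>
                 hnorm (hsub w (proj (V n) w)) \<le> \<epsilon> n * hnorm w))"
proof -
  interpret partitioned_domain \<Omega> \<Omega>s d f
    using assms by unfold_locales auto
  let ?A = normalised_solutions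
  define c where "c = Min ((\<lambda>j. Hm1norm f (\<Omega>s j)) ` {..<d})"
  have c: "0 < c" using assms(9) by (simp add: c_def)
  have c_le: "c \<le> hnorm a" if a: "a \<in> ?A" for a
  proof -
    obtain y j where "is_u \<Omega> \<Omega>s d f y a" "j < d" "y j = 1"
      using a unfolding normalised_solutions_def by blast
    then have "Hm1norm f (\<Omega>s j) \<le> hnorm a" by (rule Hm1norm_le_hnorm)
    moreover have "c \<le> Hm1norm f (\<Omega>s j)"
      unfolding c_def using \<open>j < d\<close> by (intro Min_le) auto
    ultimately show ?thesis by simp
  qed
  have AH: "?A \<subseteq> H10 \<Omega>" using is_uD(3) by (auto simp: normalised_solutions_def)
  obtain C where C: "\<And>a. a \<in> ?A \<Longrightarrow> hnorm a \<le> C" by (rule normalised_solutions_bounded) blast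
  have "\<Omega> \<noteq> {}" using \<Omega>s_nonempty[OF \<open>0 < d\<close>] \<Omega>s_subset[OF \<open>0 < d\<close>] by blast
  then have "\<exists>b. (\<forall>n. orthonormal_upto \<Omega> b n) \<and>
      (\<forall>\<epsilon>>0. \<exists>N. \<forall>n\<ge>N. \<forall>a\<in>?A. hnorm (residual b n a) \<le> \<epsilon>)"
    by (rule orthonormal_greedy[OF assms(1) _ AH C normalised_solutions_totally_bounded])
  then obtain b where b: "\<And>n. orthonormal_upto \<Omega> b n"
    and conv: "\<And>\<epsilon>. 0 < \<epsilon> \<Longrightarrow> \<exists>N. \<forall>n\<ge>N. \<forall>a\<in>?A. hnorm (residual b n a) \<le> \<epsilon>"
    by blast
  define V where "V n = {hlin n k b | k. True}" for n
  \<comment> \<open>Inserting 0 keeps the set nonempty even if \<open>?A\<close> is empty, and makes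
    \<open>R n\<close> nonnegative.\<close>
  define R where "R n = Sup (insert 0 ((\<lambda>a. hnorm (residual b n a)) ` ?A))" for n
  have "hnorm (residual b n a) \<le> C" if "a \<in> ?A" for n a
  proof -
    have "hnorm (residual b n a) \<le> hnorm (residual b 0 a)"
      using b that AH by (intro hnorm_residual_antimono) auto
    then show ?thesis using C[OF that] by (simp add: residual_def hlin_def hsub_def)
  qed
  then have bdd: "bdd_above (insert 0 ((\<lambda>a. hnorm (residual b n a)) ` ?A))" for n
    by (subst bdd_above_insert) (rule bdd_aboveI2)
  have R_ge: "hnorm (residual b n a) \<le> R n" if "a \<in> ?A" for n a
    unfolding R_def using that by (intro cSup_upper bdd) auto
  have R_nonneg: "0 \<le> R n" for n
    unfolding R_def by (intro cSup_upper bdd) auto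
  have "R \<longlonglongrightarrow> 0"
  proof (rule LIMSEQ_I)
    fix e :: real assume "0 < e"
    then obtain N where N: "\<forall>n\<ge>N. \<forall>a\<in>?A. hnorm (residual b n a) \<le> e / 2"
      using conv[of "e / 2"] by auto
    have "R n \<le> e / 2" if "N \<le> n" for n
      unfolding R_def using N that \<open>0 < e\<close> by (intro cSup_least) auto
    then show "\<exists>N. \<forall>n\<ge>N. norm (R n - 0) < e"
      using R_nonneg \<open>0 < e\<close> by (intro exI[of _ N]) (force simp: field_simps)
  qed
  \<comment> \<open>The second summand keeps the bound positive when \<open>R n = 0\<close>;
    \<open>Suc n\<close> keeps it positive at \<open>n = 0\<close> too.\<close>
  define \<epsilon> where "\<epsilon> n = R n / c + 1 / real (Suc n)" for n
  have "\<epsilon> \<longlonglongrightarrow> 0 / c + 0"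
    unfolding \<epsilon>_def using \<open>R \<longlonglongrightarrow> 0\<close> c LIMSEQ_Suc[OF lim_1_over_n[where 'a = real]]
    by (intro tendsto_add tendsto_divide tendsto_const) auto
  moreover have \<epsilon>_pos: "0 < \<epsilon> n" for n
    unfolding \<epsilon>_def using R_nonneg[of n] c by (intro add_nonneg_pos) auto
  moreover have "hnorm (hsub w (proj (V n) w)) \<le> \<epsilon> n * hnorm w"
    if pos: "\<forall>j<d. 0 < y j" and u: "is_u \<Omega> \<Omega>s d f y w" for n y w
  proof -
    note wH = is_uD(3)[OF u]
    have proj: "hsub w (proj (V n) w) = residual b n w"
      unfolding V_def using b wH by (rule hsub_proj_orthonormal)
    obtain j where j: "j < d" "\<And>i. i < d \<Longrightarrow> y j \<le> y i"
      using ex_min_if_finite[of "y ` {..<d}"] \<open>0 < d\<close> by (force simp: not_less)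
    show ?thesis
    proof (cases "y j = \<infinity>")
      case True
      then have "infs y = {..<d}" using j(2) by (auto simp: infs_def)
      then have "hip w w = 0"
        using aU_eq_0_on_infs[OF is_uD(1)[OF u]] by (simp add: hip_eq_sum_aU[OF wH wH])
      moreover have "hip (residual b n w) (residual b n w) \<le> hip w w"
        by (simp add: hip_residual_self[OF b wH] sum_nonneg)
      ultimately have "hnorm (residual b n w) = 0"
        using hip_nonneg[of "residual b n w"] by (simp add: hnorm_def)
      then show ?thesis
        using \<epsilon>_pos[of n] hnorm_nonneg[of w] by (simp add: proj)
    next
      case False
      then obtain \<mu> where \<mu>: "y j = ereal \<mu>" "0 < \<mu>"
        using pos j(1) by (cases "y j") force+
      have "is_u \<Omega> \<Omega>s d f (\<lambda>i. y i / ereal \<mu>) (hscale \<mu> w)"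
        using u \<mu>(2) pos by (intro is_u_hscale) auto
      moreover have "1 \<le> y i / ereal \<mu>" if "i < d" for i
        using j(2)[OF that] \<mu> by (cases "y i") (auto simp: field_simps)
      moreover have "y j / ereal \<mu> = 1" using \<mu> by (simp add: one_ereal_def)
      ultimately have A: "hscale \<mu> w \<in> ?A"
        unfolding normalised_solutions_def using j(1) by blast
      \<comment> \<open>The residual is linear in \<open>w\<close>, so the estimate for the rescaled
        solution transfers back to \<open>w\<close>.\<close>
      have "residual b n (hscale \<mu> w) = hscale \<mu> (residual b n w)"
        by (simp add: residual_def hsub_def hscale_def[of \<mu>] hlin_def hip_hscale_left[unfolded hscale_def]
            sum_distrib_left scaleR_sum_right algebra_simps)
      then have "\<mu> * hnorm (residual b n w) \<le> R n"
        using R_ge[OF A, of n] \<mu>(2) by (simp add: hnorm_hscale)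
      \<comment> \<open>The lower bound \<open>c\<close> on the norm converts the absolute error
        into a relative one.\<close>
      also have "\<dots> \<le> R n / c * hnorm (hscale \<mu> w)"
        using mult_left_mono[OF c_le[OF A], of "R n / c"] R_nonneg[of n] c by simp
      also have "\<dots> \<le> \<epsilon> n * hnorm (hscale \<mu> w)"
        unfolding \<epsilon>_def by (intro mult_right_mono hnorm_nonneg) simp
      also have "\<dots> = \<mu> * (\<epsilon> n * hnorm w)" using \<mu>(2) by (simp add: hnorm_hscale)
      finally show ?thesis using \<mu>(2) by (simp add: proj)
    qed
  qed
  moreover have "subspace_dim \<Omega> (V n) n" for n
    unfolding V_def using b by (rule orthonormal_subspace_dim)
  ultimately show ?thesis by (intro exI[of _ V] exI[of _ \<epsilon>]) auto
qed

end
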